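(* Let $d\ge 2$, let $\mathcal L$ be a sibling $d$-invariant lamination, and let $\mathcal S\subset\mathcal L$ be a full sibling collection, consisting of a leaf $\ell_1$ and its siblings, such that $\sigma_d(\ell_1)$ is not a diameter. Then the following hold. (1) If some leaf in $\mathcal S$ is of length $>\frac1{2d}$, then there is a nonempty central strip $C$ corresponding to $\mathcal S$. (2) The dual graph of the sibling portrait corresponding to $\mathcal S$ is a planar bicolored tree where $C$-regions are colored one color and $R$-regions the other.
   Context: Let $\mathbb D$ be the open unit disk in $\mathbb C$, $\overline{\mathbb D}$ its closure, and $\mathbb S$ the unit circle, parameterized as $\mathbb R/\mathbb Z$. For $d\ge2$, $\sigma_d:\mathbb S\to\mathbb S$ is $\sigma_d(t)=dt \pmod 1$. A lamination $\mathcal L$ is a collection of chords of $\overline{\mathbb D}$, called leaves, such that any two leaves meet, if at all, in a point of $\mathbb S$, and such that $\mathbb S\cup\bigcup\mathcal L$ is closed in $\overline{\mathbb D}$. Degenerate leaves are allowed; all points of $\mathbb S$ are degenerate leaves. A leaf with endpoints $a,b$ is written $\overline{ab}$, and $\sigma_d(\overline{ab})$ denotes the chord (possibly a point) $\overline{\sigma_d(a)\sigma_d(b)}$. The length $|\overline{ab}|\in[0,\frac12]$ is the smaller of the lengths, in the parameterization $\mathbb R/\mathbb Z$, of the two arcs of $\mathbb S$ between $a$ and $b$. If $\sigma_d(\ell_1)=\ell'$ is a non-degenerate leaf, a leaf $\ell_2$ disjoint from $\ell_1$ with $\sigma_d(\ell_2)=\ell'$ is a sibling of $\ell_1$. A collection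 $\{\ell_1,\dots,\ell_d\}\subset\mathcal L$ is a full sibling collection if $\sigma_d(\ell_i)=\ell'$ for every $i$ (with $\ell'$ a fixed non-degenerate leaf) and $\ell_i\cap\ell_j=\emptyset$ for $i\ne j$. $\mathcal L$ is sibling $d$-invariant if: (i) $\sigma_d(\ell)\in\mathcal L$ for every $\ell\in\mathcal L$; (ii) for every non-degenerate $\ell'\in\mathcal L$ there is $\ell\in\mathcal L$ with $\sigma_d(\ell)=\ell'$; (iii) for every $\ell_1\in\mathcal L$ with $\sigma_d(\ell_1)=\ell'$ non-degenerate, there is a full sibling collection $\{\ell_1,\dots,\ell_d\}\subset\mathcal L$ with $\sigma_d(\ell_i)=\ell'$ for all $i$. The sibling portrait $S$ of a full sibling collection $\mathcal S$ is the collection of regions of the disk complementary to the leaves of $\mathcal S$. A complementary region is a $C$-region if all of the arcs in which its closure meets the circle are short (length $<\frac1{2d}$), and an $R$-region if all of these arcs are long (length $>\frac1{2d}$). The degree of a complementary region is the number of leaves of $\mathcal S$ in its boundary (equivalently, the number of circular arcs in its boundary). The central strip corresponding to $\mathcal S$ is the closure of the union of all $C$-regions of degree at least $2$. The dual graph of $S$ has one vertex for each complementary region, and one edge for each leaf of $\mathcal S$, joining the vertices of the two regions on whose boundary the leaf lies. A tree is bicolored if its vertices are labeled with two colors such that no edge connects vertices of the same color. *)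

theory Defs
  imports "HOL-Analysis.Analysis"
begin

section \<open>The circle and the map \<open>\<sigma>\<^sub>d\<close>\<close>

text \<open>The circle is \<open>sphere 0 1\<close> in the complex plane. It is identified with the reals modulo 1
  by \<open>circ\<close>; \<open>param\<close> picks the representative of the parameter in \<open>[0,1)\<close>.\<close>

definition circ :: "real \<Rightarrow> complex" where
  "circ t = cis (2 * pi * t)"

definition param :: "complex \<Rightarrow> real" where
  "param z = Arg2pi z / (2 * pi)"

definition sigma_map :: "nat \<Rightarrow> complex \<Rightarrow> complex" where
  "sigma_map d z = circ (frac (real d * param z))"

lemma circ_in_sphere: "circ t \<in> sphere 0 1"
  by (simp add: circ_def)

lemma circ_add_int: "circ (t + of_int k) = circ t"
proof -
  have "cis (2 * pi * (t + of_int k)) = cis (2 * pi * t) * cis (2 * pi * of_int k)"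
    by (simp add: cis_mult algebra_simps)
  then show ?thesis
    by (simp add: circ_def cis_multiple_2pi)
qed

lemma circ_frac: "circ (frac t) = circ t"
  using circ_add_int[of t "- \<lfloor>t\<rfloor>"] by (simp add: frac_def)

lemma circ_param: "z \<in> sphere 0 1 \<Longrightarrow> circ (param z) = z"
  using Arg2pi_eq[of z] by (simp add: circ_def param_def cis_conv_exp mult.commute)

lemma param_bounds: "0 \<le> param z" "param z < 1"
  using Arg2pi_ge_0[of z] Arg2pi_lt_2pi[of z] by (simp_all add: param_def)

lemma sigma_map_eq_power: "z \<in> sphere 0 1 \<Longrightarrow> sigma_map d z = z ^ d"
proof -
  assume z: "z \<in> sphere 0 1"
  have "sigma_map d z = cis (real d * (2 * pi * param z))"
    by (simp add: sigma_map_def circ_frac) (simp add: circ_def algebra_simps)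
  also have "\<dots> = circ (param z) ^ d"
    by (simp only: circ_def Complex.DeMoivre)
  finally show ?thesis
    using z by (simp add: circ_param)
qed

lemma sigma_map_circ: "sigma_map d (circ t) = circ (real d * t)"
  by (simp only: sigma_map_eq_power[OF circ_in_sphere])
     (simp only: circ_def Complex.DeMoivre mult_ac)

text \<open>Length in the parametrization by the reals modulo 1; the whole circle has length 1.\<close>

definition arc_length :: "complex set \<Rightarrow> real" where
  "arc_length A = measure lebesgue {t \<in> {0..<1}. circ t \<in> A}"

text \<open>The closed arc run through counterclockwise from \<open>a\<close> to \<open>b\<close>; it is \<open>{a}\<close> if \<open>a = b\<close>.\<close>

definition ccw_arc :: "complex \<Rightarrow> complex \<Rightarrow> complex set" where
  "ccw_arc a b = circ ` {param a .. param a + frac (param b - param a)}"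


section \<open>Chords\<close>

text \<open>A chord is represented by the set of its points; a one-point set is a degenerate chord.\<close>

definition chord :: "complex set \<Rightarrow> bool" where
  "chord l \<longleftrightarrow> (\<exists>a\<in>sphere 0 1. \<exists>b\<in>sphere 0 1. l = closed_segment a b)"

definition degenerate :: "complex set \<Rightarrow> bool" where
  "degenerate l \<longleftrightarrow> (\<exists>z. l = {z})"

definition diameter_chord :: "complex set \<Rightarrow> bool" where
  "diameter_chord l \<longleftrightarrow> (\<exists>a\<in>sphere 0 1. l = closed_segment a (- a))"

text \<open>A chord determines its endpoints \<open>a\<close>, \<open>b\<close> up to order, so the minimum below is over the
  two arcs \<open>ccw_arc a b\<close> and \<open>ccw_arc b a\<close>.\<close>

definition leaf_length :: "complex set \<Rightarrow> real" where
  "leaf_length l =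
     Min {arc_length (ccw_arc a b) | a b. a \<in> sphere 0 1 \<and> b \<in> sphere 0 1 \<and> l = closed_segment a b}"

text \<open>The endpoints of a chord are its points on the circle; see \<open>leaf_map_closed_segment\<close>.\<close>

definition leaf_map :: "nat \<Rightarrow> complex set \<Rightarrow> complex set" where
  "leaf_map d l = convex hull (sigma_map d ` (l \<inter> sphere 0 1))"

lemma closed_segment_Int_sphere:
  fixes a b :: complex
  assumes "a \<in> sphere 0 1" "b \<in> sphere 0 1"
  shows "closed_segment a b \<inter> sphere 0 1 = {a, b}"
proof
  show "closed_segment a b \<inter> sphere 0 1 \<subseteq> {a, b}"
  proof
    fix x assume x: "x \<in> closed_segment a b \<inter> sphere 0 1"
    show "x \<in> {a, b}"
    proof (rule ccontr)
      assume "x \<notin> {a, b}"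
      then have "x \<in> open_segment a b"
        using x by (auto simp: open_segment_def)
      then have "dist 0 x < dist 0 a \<or> dist 0 x < dist 0 b"
        by (rule dist_decreases_open_segment[rule_format])
      then show False
        using x assms by simp
    qed
  qed
qed (use assms in auto)

lemma leaf_map_closed_segment:
  assumes "a \<in> sphere 0 1" "b \<in> sphere 0 1"
  shows "leaf_map d (closed_segment a b) = closed_segment (sigma_map d a) (sigma_map d b)"
  unfolding leaf_map_def closed_segment_Int_sphere[OF assms]
  by (simp add: segment_convex_hull)


section \<open>Sibling invariant laminations\<close>

definition lamination :: "complex set set \<Rightarrow> bool" where
  "lamination L \<longleftrightarrow>
     (\<forall>l\<in>L. chord l) \<and>
     (\<forall>z\<in>sphere 0 1. {z} \<in> L) \<and>
     (\<forall>l1\<in>L. \<forall>l2\<in>L. l1 \<noteq> l2 \<longrightarrow> l1 \<inter> l2 = {} \<or> (\<exists>z\<in>sphere 0 1. l1 \<inter> l2 = {z})) \<and>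
     closed (sphere 0 1 \<union> \<Union> L)"

text \<open>The \<open>d\<close> leaves of a full sibling collection are nonempty and pairwise disjoint, hence distinct,
  so the family is a set of cardinality \<open>d\<close>.\<close>

definition full_sibling_collection :: "nat \<Rightarrow> complex set set \<Rightarrow> complex set set \<Rightarrow> bool" where
  "full_sibling_collection d L S \<longleftrightarrow>
     S \<subseteq> L \<and> finite S \<and> card S = d \<and>
     (\<exists>l'\<in>L. \<not> degenerate l' \<and> (\<forall>l\<in>S. leaf_map d l = l')) \<and>
     (\<forall>l1\<in>S. \<forall>l2\<in>S. l1 \<noteq> l2 \<longrightarrow> l1 \<inter> l2 = {})"

definition sibling_invariant :: "nat \<Rightarrow> complex set set \<Rightarrow> bool" where
  "sibling_invariant d L \<longleftrightarrow>
     (\<forall>l\<in>L. leaf_map d l \<in> L) \<and>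
     (\<forall>l'\<in>L. \<not> degenerate l' \<longrightarrow> (\<exists>l\<in>L. leaf_map d l = l')) \<and>
     (\<forall>l1\<in>L. \<not> degenerate (leaf_map d l1) \<longrightarrow>
        (\<exists>S. full_sibling_collection d L S \<and> l1 \<in> S \<and> (\<forall>l\<in>S. leaf_map d l = leaf_map d l1)))"


section \<open>Sibling portraits and central strips\<close>

definition sibling_portrait :: "complex set set \<Rightarrow> complex set set" where
  "sibling_portrait S = components (ball 0 1 - \<Union> S)"

definition boundary_arcs :: "complex set \<Rightarrow> complex set set" where
  "boundary_arcs R = components (closure R \<inter> sphere 0 1)"

definition C_region :: "nat \<Rightarrow> complex set set \<Rightarrow> complex set \<Rightarrow> bool" where
  "C_region d S R \<longleftrightarrow>
     R \<in> sibling_portrait S \<and> (\<forall>A\<in>boundary_arcs R. arc_length A < 1 / (2 * real d))"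

definition R_region :: "nat \<Rightarrow> complex set set \<Rightarrow> complex set \<Rightarrow> bool" where
  "R_region d S R \<longleftrightarrow>
     R \<in> sibling_portrait S \<and> (\<forall>A\<in>boundary_arcs R. arc_length A > 1 / (2 * real d))"

definition region_degree :: "complex set set \<Rightarrow> complex set \<Rightarrow> nat" where
  "region_degree S R = card {l \<in> S. l \<subseteq> frontier R}"

definition central_strip :: "nat \<Rightarrow> complex set set \<Rightarrow> complex set" where
  "central_strip d S = closure (\<Union> {R. C_region d S R \<and> region_degree S R \<ge> 2})"


section \<open>Graphs\<close>

text \<open>Undirected graphs with named edges: parallel edges are allowed, and a loop is an edge with a
  single end. Edges must be named because a priori two leaves could separate the same two regions.\<close>

record ('v, 'e) multigraph =
  mverts :: "'v set"
  medges :: "'e set"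
  mends :: "'e \<Rightarrow> 'v set"

definition wf_multigraph :: "('v, 'e) multigraph \<Rightarrow> bool" where
  "wf_multigraph G \<longleftrightarrow>
     (\<forall>e\<in>medges G. mends G e \<subseteq> mverts G \<and> card (mends G e) \<in> {1, 2})"

definition mwalk :: "('v, 'e) multigraph \<Rightarrow> 'v list \<Rightarrow> 'e list \<Rightarrow> bool" where
  "mwalk G vs es \<longleftrightarrow>
     length vs = Suc (length es) \<and> set vs \<subseteq> mverts G \<and> set es \<subseteq> medges G \<and>
     (\<forall>i<length es. mends G (es ! i) = {vs ! i, vs ! Suc i})"

definition mconnected :: "('v, 'e) multigraph \<Rightarrow> bool" where
  "mconnected G \<longleftrightarrow> mverts G \<noteq> {} \<and>
     (\<forall>u\<in>mverts G. \<forall>v\<in>mverts G. \<exists>vs es. mwalk G vs es \<and> hd vs = u \<and> last vs = v)"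

text \<open>Requiring distinct edges excludes walking back along the same edge; loops and pairs of parallel
  edges do give cycles.\<close>

definition mcycle :: "('v, 'e) multigraph \<Rightarrow> 'v list \<Rightarrow> 'e list \<Rightarrow> bool" where
  "mcycle G vs es \<longleftrightarrow>
     mwalk G vs es \<and> es \<noteq> [] \<and> hd vs = last vs \<and> distinct (tl vs) \<and> distinct es"

definition mtree :: "('v, 'e) multigraph \<Rightarrow> bool" where
  "mtree G \<longleftrightarrow> wf_multigraph G \<and> mconnected G \<and> (\<nexists>vs es. mcycle G vs es)"

definition bicoloring :: "('v, 'e) multigraph \<Rightarrow> 'v set \<Rightarrow> 'v set \<Rightarrow> bool" where
  "bicoloring G A B \<longleftrightarrow>
     A \<union> B = mverts G \<and> A \<inter> B = {} \<and>
     (\<forall>e\<in>medges G. \<forall>u v. mends G e = {u, v} \<longrightarrow> \<not> (u \<in> A \<and> v \<in> A) \<and> \<not> (u \<in> B \<and> v \<in> B))"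

text \<open>A drawing in the plane: vertices are distinct points, edges are simple curves joining their
  ends (closed ones for loops), and curves meet vertices and each other only in common ends.\<close>

definition plane_drawing ::
  "('v, 'e) multigraph \<Rightarrow> ('v \<Rightarrow> complex) \<Rightarrow> ('e \<Rightarrow> real \<Rightarrow> complex) \<Rightarrow> bool" where
  "plane_drawing G pos crv \<longleftrightarrow>
     inj_on pos (mverts G) \<and>
     (\<forall>e\<in>medges G. simple_path (crv e) \<and>
        {pathstart (crv e), pathfinish (crv e)} = pos ` mends G e \<and>
        path_image (crv e) \<inter> pos ` mverts G = pos ` mends G e) \<and>
     (\<forall>e\<in>medges G. \<forall>f\<in>medges G. e \<noteq> f \<longrightarrow>
        path_image (crv e) \<inter> path_image (crv f) \<subseteq> pos ` mends G e \<inter> pos ` mends G f)"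

definition planar :: "('v, 'e) multigraph \<Rightarrow> bool" where
  "planar G \<longleftrightarrow> (\<exists>pos crv. plane_drawing G pos crv)"

definition dual_graph :: "complex set set \<Rightarrow> (complex set, complex set) multigraph" where
  "dual_graph S =
     \<lparr> mverts = sibling_portrait S, medges = S,
       mends = (\<lambda>l. {R \<in> sibling_portrait S. l \<subseteq> frontier R}) \<rparr>"

end

theory Submission
  imports Defs "HOL-Computational_Algebra.Polynomial"
begin

text \<open>The leaves are \<open>d\<close> disjoint chords, so a complementary region is the set of points of the open
  disk on which \<open>d\<close> real affine functions, one for each leaf, have prescribed signs. Crossing a leaf
  changes exactly one sign; this makes the dual graph a tree, and it is drawn in the plane by segments
  from interior points of the regions to the midpoints of the leaves.

  If the image leaf has ends \<open>P\<close> and \<open>Q\<close>, the ends of the leaves are exactly the \<open>d\<close>-th roots of \<open>P\<close>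
  and \<open>Q\<close>. Hence on the circle the product of the \<open>d\<close> affine functions at \<open>z\<close> is a constant multiple of
  the affine function of the image leaf at \<open>z\<^sup>d\<close>. The product of the signs of a region thus decides
  whether its boundary arcs are short or long, and it changes across every leaf. A \<open>C\<close>-region of
  degree one would cut off a single short arc, so a long leaf bounds a \<open>C\<close>-region of degree at
  least two.\<close>

section \<open>Sides of a chord and arcs of the circle\<close>

text \<open>This is the cross product of \<open>q - p\<close> and \<open>z - p\<close>: real affine
  in \<open>z\<close>, zero on the line through \<open>p\<close> and \<open>q\<close>, positive to
  the left when going from \<open>p\<close> to \<open>q\<close>.\<close>

definition side :: "complex \<Rightarrow> complex \<Rightarrow> complex \<Rightarrow> real" where
  "side p q z = Im ((z - p) * cnj (q - p))"

lemma side_affine: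
  "side p q ((1 - t) *\<^sub>R x + t *\<^sub>R y) = (1 - t) * side p q x + t * side p q y"
  by (simp add: side_def algebra_simps)

lemma continuous_on_side [continuous_intros]:
  "continuous_on A f \<Longrightarrow> continuous_on A (\<lambda>x. side p q (f x))"
  unfolding side_def by (intro continuous_intros)

text \<open>Locates points of a line by their norm: for distinct \<open>p\<close> and
  \<open>q\<close>, norm at most 1 means that \<open>t * (1 - t)\<close> is nonnegative, so the line
  meets the closed disk in the chord only.\<close>

lemma norm_affine_combination_sq:
  fixes p q :: complex
  assumes "norm p = 1" "norm q = 1"
  shows "(norm ((1 - t) *\<^sub>R p + t *\<^sub>R q))\<^sup>2 = 1 - t * (1 - t) * (norm (q - p))\<^sup>2"
proof -
  have "(Re p)\<^sup>2 + (Im p)\<^sup>2 = 1" "(Re q)\<^sup>2 + (Im q)\<^sup>2 = 1"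
    using assms by (simp_all add: cmod_def)
  then show ?thesis
    by (simp add: cmod_power2) algebra
qed

lemma side_eq_0_iff:
  assumes "norm p = 1" "norm q = 1" "p \<noteq> q" "norm z \<le> 1"
  shows "side p q z = 0 \<longleftrightarrow> z \<in> closed_segment p q"
proof
  assume "side p q z = 0"
  \<comment> \<open>\<open>w\<close> is the coordinate of \<open>z\<close> that is 0 at
    \<open>p\<close> and 1 at \<open>q\<close>; \<open>side p q z = 0\<close> says that it is
    real.\<close>
  define w where "w = (z - p) / (q - p)"
  have "w = (z - p) * cnj (q - p) / of_real ((norm (q - p))\<^sup>2)"
    unfolding w_def by (simp only: complex_norm_square) (use assms in simp)
  with \<open>side p q z = 0\<close> have "Im w = 0"
    by (simp add: side_def Im_divide_of_real)
  then have "w = of_real (Re w)"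
    by (simp add: complex_eq_iff)
  then have z: "z = (1 - Re w) *\<^sub>R p + Re w *\<^sub>R q"
    using assms by (simp add: w_def scaleR_conv_of_real field_simps)
  have "(norm z)\<^sup>2 \<le> 1"
    using assms by (simp add: power_le_one)
  then have "0 \<le> Re w * (1 - Re w) * (norm (q - p))\<^sup>2"
    unfolding z norm_affine_combination_sq[OF assms(1,2)] by simp
  moreover have "0 < (norm (q - p))\<^sup>2"
    using assms by simp
  ultimately have "0 \<le> Re w * (1 - Re w)"
    by (simp add: zero_le_mult_iff)
  then have "0 \<le> Re w" "Re w \<le> 1"
    by (auto simp: zero_le_mult_iff)
  with z show "z \<in> closed_segment p q"
    by (auto simp: in_segment)
next
  assume "z \<in> closed_segment p q"
  then obtain t where "z = (1 - t) *\<^sub>R p + t *\<^sub>R q"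
    by (auto simp: in_segment)
  then show "side p q z = 0"
    by (simp add: side_affine) (simp add: side_def algebra_simps)
qed

lemma side_zero_on_segment:
  assumes "side p q x * side p q y \<le> 0"
  obtains w where "w \<in> closed_segment x y" "side p q w = 0"
proof -
  define f where "f = (\<lambda>t. side p q ((1 - t) *\<^sub>R x + t *\<^sub>R y))"
  have "\<exists>t. 0 \<le> t \<and> t \<le> 1 \<and> f t = 0"
  proof -
    have c: "continuous_on {0..1} f"
      unfolding f_def by (intro continuous_intros)
    have "f 0 * f 1 \<le> 0"
      using assms by (simp add: f_def)
    then consider "f 0 \<le> 0" "0 \<le> f 1" | "f 1 \<le> 0" "0 \<le> f 0"
      by (auto simp: mult_le_0_iff)
    then show ?thesis
      using IVT'[of f 0 0 1] IVT2'[of f 1 0 0] c by cases auto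
  qed
  then show ?thesis
    using that unfolding f_def in_segment by blast
qed

text \<open>On the unit circle conjugation is inversion, which turns the affine function into a
  rational function with zeros \<open>p\<close> and \<open>q\<close>. In this form the functions of
  all leaves can be multiplied.\<close>

lemma side_circle:
  assumes "norm p = 1" "norm q = 1" "norm z = 1"
  shows "of_real (side p q z) = (p - q) / (2 * \<i> * p * q) * ((z - p) * (z - q) / z)"
proof -
  have nz: "p \<noteq> 0" "q \<noteq> 0" "z \<noteq> 0"
    using assms by auto
  have c: "cnj p = 1 / p" "cnj q = 1 / q" "cnj z = 1 / z"
    using assms nz complex_norm_square[of p] complex_norm_square[of q] complex_norm_square[of z]
    by (simp_all add: field_simps)
  have "2 * \<i> * of_real (side p q z) = (z - p) * cnj (q - p) - cnj ((z - p) * cnj (q - p))"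
    unfolding side_def by (simp add: complex_eq_iff algebra_simps)
  also have "\<dots> = (p - q) / (p * q) * ((z - p) * (z - q) / z)"
    using nz by (simp add: c field_simps)
  finally show ?thesis
    using nz by (simp add: field_simps)
qed

text \<open>A difference of two points of the circle is a sine times a unit vector at the mean
  angle, turned by a right angle. The three resulting sines give the sign on each of the two
  arcs.\<close>

lemma side_circ:
  "side (circ u) (circ (u + h)) (circ t) = 4 * sin (pi * h) * sin (pi * (t - u)) * sin (pi * (t - u - h))"
proof -
  have diff: "circ y - circ x = (2 * sin (pi * (y - x))) *\<^sub>R (\<i> * cis (pi * (x + y)))" for x y
  proof -
    have "2 * pi * y = pi * (x + y) + pi * (y - x)" "2 * pi * x = pi * (x + y) - pi * (y - x)"
      by (simp_all add: algebra_simps)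
    then show ?thesis
      unfolding circ_def complex_eq_iff by (simp add: cos_add cos_diff sin_add sin_diff)
  qed
  have "side (circ u) (circ (u + h)) (circ t) =
     4 * sin (pi * h) * sin (pi * (t - u)) * Im (cis (pi * (u + t)) * cnj (cis (pi * (u + (u + h)))))"
    unfolding side_def diff by (simp add: algebra_simps)
  also have "cis (pi * (u + t)) * cnj (cis (pi * (u + (u + h)))) = cis (pi * (t - u - h))"
    by (simp add: cis_cnj cis_mult algebra_simps)
  finally show ?thesis by simp
qed

lemma side_circ_neg:
  assumes "0 < h" "h < 1" "u < t" "t < u + h"
  shows "side (circ u) (circ (u + h)) (circ t) < 0"
proof -
  have "0 < sin (pi * h)" "0 < sin (pi * (t - u))" "0 < sin (pi * (u + h - t))"
    using assms by (auto intro!: sin_gt_zero)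
  moreover have "sin (pi * (t - u - h)) = - sin (pi * (u + h - t))"
    by (simp flip: sin_minus add: algebra_simps)
  ultimately show ?thesis
    unfolding side_circ by simp
qed

lemma side_circ_pos:
  assumes "0 < h" "h < 1" "u + h < t" "t < u + 1"
  shows "side (circ u) (circ (u + h)) (circ t) > 0"
proof -
  have "0 < sin (pi * h)" "0 < sin (pi * (t - u))" "0 < sin (pi * (t - u - h))"
    using assms by (auto intro!: sin_gt_zero)
  then show ?thesis
    unfolding side_circ by simp
qed

section \<open>Parametrized arcs of the circle and their lengths\<close>

lemma circ_eq_iff: "circ x = circ y \<longleftrightarrow> x - y \<in> \<int>"
proof -
  have "circ x = circ y \<longleftrightarrow> cis (2 * pi * (x - y)) = 1"
    by (simp add: circ_def right_diff_distrib cis_divide[symmetric])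
  also have "\<dots> \<longleftrightarrow> cos (2 * pi * (x - y)) = 1"
    by (auto simp: complex_eq_iff cos_one_sin_zero)
  also have "\<dots> \<longleftrightarrow> (\<exists>k::int. x - y = of_int k)"
    unfolding cos_one_2pi_int by (intro ex_cong1) auto
  finally show ?thesis by (auto elim: Ints_cases)
qed

lemma circ_power: "circ t ^ n = circ (real n * t)"
  unfolding circ_def Complex.DeMoivre by (simp only: mult_ac)

lemma norm_circ [simp]: "norm (circ t) = 1"
  by (simp add: circ_def)

lemma continuous_on_circ [continuous_intros]:
  "continuous_on A f \<Longrightarrow> continuous_on A (\<lambda>x. circ (f x))"
  unfolding circ_def by (intro continuous_intros)

lemma circ_surj_interval:
  assumes "norm z = 1"
  obtains t where "u \<le> t" "t < u + 1" "z = circ t"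
proof
  show "z = circ (u + frac (param z - u))"
    using circ_param[of z] assms
    by (subst circ_eq_iff[of "param z", THEN iffD2, symmetric]) (auto simp: frac_def)
qed (auto simp: frac_lt_1)

lemma ccw_arc_circ:
  assumes "0 \<le> h" "h < 1"
  shows "ccw_arc (circ s) (circ (s + h)) = circ ` {s..s + h}"
proof -
  have "circ (param (circ s)) = circ s" "circ (param (circ (s + h))) = circ (s + h)"
    by (simp_all add: circ_param)
  then obtain k m :: int where k: "param (circ s) = s + k" and m: "param (circ (s + h)) = s + h + m"
    unfolding circ_eq_iff by (metis Ints_cases add.commute diff_add_cancel)
  have "frac (param (circ (s + h)) - param (circ s)) = h"
    using assms unfolding k m frac_unique_iff by simp
  then have "ccw_arc (circ s) (circ (s + h)) = circ ` (\<lambda>t. t + of_int k) ` {s..s + h}"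
    unfolding ccw_arc_def k by (simp add: add.commute add.left_commute)
  then show ?thesis
    by (simp only: image_image circ_add_int)
qed

lemma arc_length_circ:
  assumes "0 \<le> h" "h < 1"
  shows "arc_length (circ ` {s..s + h}) = h"
proof -
  define r where "r = frac s"
  have r: "0 \<le> r" "r < 1"
    by (auto simp: r_def frac_lt_1)
  have "circ ` {s..s + h} = circ ` (\<lambda>t. t + of_int \<lfloor>s\<rfloor>) ` {r..r + h}"
    by (simp add: r_def frac_def)
  then have arc: "circ ` {s..s + h} = circ ` {r..r + h}"
    by (simp only: image_image circ_add_int)
  \<comment> \<open>With the start moved into \<open>[0,1)\<close>, the arc passes the parameter 1
    at most once; the part from there on reappears at the beginning of \<open>[0,1)\<close>.\<close>
  have "{t \<in> {0..<1}. circ t \<in> circ ` {r..r + h}} =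
      (if r + h < 1 then {r..r + h} else {r..<1} \<union> {0..r + h - 1})" (is "?A = ?B")
  proof (intro set_eqI iffI)
    fix t assume "t \<in> ?A"
    then obtain x where x: "0 \<le> t" "t < 1" "r \<le> x" "x \<le> r + h" "t - x \<in> \<int>"
      by (auto simp: circ_eq_iff)
    then obtain k :: int where k: "t = x + k"
      by (metis Ints_cases add.commute diff_add_cancel)
    then have "k = 0 \<or> k = - 1"
      using x assms r by linarith
    then show "t \<in> ?B"
      using x r assms k by auto
  next
    fix t assume t: "t \<in> ?B"
    show "t \<in> ?A"
    proof (cases "r \<le> t")
      case True
      then show ?thesis using t r assms by (auto split: if_splits)
    next
      case False
      then have "circ t = circ (t + 1)" "t + 1 \<in> {r..r + h}" "0 \<le> t" "t < 1"
        using t r assms circ_add_int[of t 1] by (auto split: if_splits)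
      then show ?thesis by auto
    qed
  qed
  moreover have "measure lebesgue ?B = h"
  proof (cases "r + h < 1")
    case False
    then have "measure lebesgue ({r..<1} \<union> {0..r + h - 1}) =
        measure lebesgue {r..<1} + measure lebesgue {0..r + h - 1}"
      using assms r emeasure_lborel_Ico[of r 1] by (intro measure_Union) auto
    with False show ?thesis using r assms by simp
  qed (use assms in simp)
  ultimately show ?thesis
    unfolding arc_length_def arc by simp
qed

section \<open>Segments from a point of an open convex region\<close>

lemma segment_to_closure:
  fixes R :: "complex set"
  assumes "open R" "convex R" "c \<in> R" "m \<in> closure R"
  shows "closed_segment c m \<subseteq> insert m R"
  using in_interior_closure_convex_segment[OF assms(2), of c m] assms
  by (auto simp: interior_open closed_segment_eq_open)

text \<open>A ray from a point of an open convex set meets the frontier at most once. This keeps the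
  edges drawn inside one region apart.\<close>

lemma segments_to_frontier_Int:
  fixes R :: "complex set"
  assumes "open R" "convex R" "c \<in> R" "m \<in> frontier R" "m' \<in> frontier R" "m \<noteq> m'"
  shows "closed_segment c m \<inter> closed_segment c m' \<subseteq> {c}"
proof
  fix x assume x: "x \<in> closed_segment c m \<inter> closed_segment c m'"
  have fr: "m \<notin> R" "m' \<notin> R" "m \<in> closure R" "m' \<in> closure R"
    using assms by (auto simp: frontier_def interior_open)
  \<comment> \<open>If both segments share a point off \<open>c\<close>, they run along one ray, and
    the end with the larger parameter \<open>s\<close> is no farther from \<open>c\<close>:
    \<open>q\<close> lies on the segment from \<open>c\<close> to \<open>p\<close> and, being
    different from \<open>p\<close>, inside \<open>R\<close>.\<close>
  have no: False if "0 < s" "0 \<le> t" "t \<le> s" "p \<in> closure R" "q \<notin> R" "p \<noteq> q"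
    "(1 - t) *\<^sub>R c + t *\<^sub>R p = (1 - s) *\<^sub>R c + s *\<^sub>R q" for p q s t
  proof -
    have "s *\<^sub>R (q - c) = t *\<^sub>R (p - c)"
      using that(7) by (simp add: algebra_simps)
    then have "(1 / s) *\<^sub>R (s *\<^sub>R (q - c)) = (1 / s) *\<^sub>R (t *\<^sub>R (p - c))"
      by simp
    then have "q = (1 - t / s) *\<^sub>R c + (t / s) *\<^sub>R p"
      using that(1) by (simp add: algebra_simps)
    moreover have "0 \<le> t / s" "t / s \<le> 1"
      using that by auto
    ultimately have "q \<in> closed_segment c p"
      unfolding in_segment by blast
    then show False
      using segment_to_closure[OF assms(1-3) that(4)] that by auto
  qed
  obtain t s where ts: "0 \<le> t" "t \<le> 1" "x = (1 - t) *\<^sub>R c + t *\<^sub>R m"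
      "0 \<le> s" "s \<le> 1" "x = (1 - s) *\<^sub>R c + s *\<^sub>R m'"
    using x by (auto simp: in_segment)
  show "x \<in> {c}"
  proof (rule ccontr)
    assume "x \<notin> {c}"
    then have "0 < t" "0 < s"
      using ts by (cases "t = 0"; cases "s = 0"; auto)+
    then show False
      using no[of s t m m'] no[of t s m' m] ts fr assms(6) by (cases "t \<le> s") auto
  qed
qed

lemma circ_nonzero: "circ t \<noteq> 0"
  using norm_circ[of t] by (metis norm_zero zero_neq_one)

text \<open>Both sides are monic polynomials of degree \<open>n\<close> in \<open>z\<close> that
  vanish at the \<open>n\<close> roots of \<open>c\<close>.\<close>

lemma prod_nth_roots:
  fixes c z :: complex
  assumes "c \<noteq> 0" "n > 0"
  shows "(\<Prod>w | w ^ n = c. z - w) = z ^ n - c"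
proof -
  let ?A = "{w::complex. w ^ n = c}"
  have card: "card ?A = n"
    using card_nth_roots[OF assms] .
  then have fin: "finite ?A"
    using assms by (metis card.infinite less_irrefl)
  let ?p = "\<Prod>w\<in>?A. [:- w, 1:]" and ?q = "monom 1 n - [:c:]"
  have deg: "degree ?p = n"
    using degree_prod_eq_sum_degree[of ?A "\<lambda>w. [:- w, 1:]"] card by simp
  have "lead_coeff ?p = 1"
    unfolding lead_coeff_prod by simp
  have "?p = ?q"
  proof (rule poly_eqI_degree_lead_coeff[where A = ?A and n = n])
    show "coeff ?p n = coeff ?q n"
      using \<open>lead_coeff ?p = 1\<close> assms unfolding deg by (simp add: coeff_pCons split: nat.split)
    show "degree ?q \<le> n"
      by (intro degree_diff_le degree_monom_le) auto
    show "poly ?p w = poly ?q w" if "w \<in> ?A" for w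
      using that fin by (auto simp: poly_prod poly_monom prod_zero_iff)
  qed (use card deg in auto)
  then have "poly ?p z = poly ?q z"
    by simp
  then show ?thesis
    by (simp add: poly_prod poly_monom)
qed

section \<open>Disjoint chords\<close>

text \<open>A chord is a set and does not order its ends. The functions \<open>a\<close> and
  \<open>b\<close> fix an order, and with it the sign of the affine function of each chord.\<close>

locale disjoint_chords =
  fixes S :: "complex set set" and a b :: "complex set \<Rightarrow> complex"
  assumes finite_S: "finite S"
    and S_nonempty: "S \<noteq> {}"
    and norm_ends: "l \<in> S \<Longrightarrow> norm (a l) = 1" "l \<in> S \<Longrightarrow> norm (b l) = 1"
    and ends_neq: "l \<in> S \<Longrightarrow> a l \<noteq> b l"
    and chord_eq: "l \<in> S \<Longrightarrow> l = closed_segment (a l) (b l)"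
    and chords_disjoint: "l \<in> S \<Longrightarrow> l' \<in> S \<Longrightarrow> l \<noteq> l' \<Longrightarrow> l \<inter> l' = {}"
begin

definition chord_side :: "complex set \<Rightarrow> complex \<Rightarrow> real" where
  "chord_side l z = side (a l) (b l) z"

lemma continuous_on_chord_side [continuous_intros]:
  "continuous_on A f \<Longrightarrow> continuous_on A (\<lambda>x. chord_side l (f x))"
  unfolding chord_side_def by (rule continuous_on_side)

lemma chord_side_affine: "chord_side l ((1 - t) *\<^sub>R x + t *\<^sub>R y) = (1 - t) * chord_side l x + t * chord_side l y"
  unfolding chord_side_def by (rule side_affine)

lemma chord_side_eq_0_iff: "l \<in> S \<Longrightarrow> norm z \<le> 1 \<Longrightarrow> chord_side l z = 0 \<longleftrightarrow> z \<in> l"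
  using side_eq_0_iff[of "a l" "b l" z] norm_ends ends_neq chord_eq unfolding chord_side_def by blast

lemma ends_in: "l \<in> S \<Longrightarrow> a l \<in> l" "l \<in> S \<Longrightarrow> b l \<in> l"
  using chord_eq by blast+

lemma convex_chord: "l \<in> S \<Longrightarrow> convex l"
  using chord_eq by (metis convex_closed_segment)

lemma chord_subset_cball: "l \<in> S \<Longrightarrow> z \<in> l \<Longrightarrow> norm z \<le> 1"
  using closed_segment_subset[of "a l" "cball 0 1" "b l"] chord_eq[of l] norm_ends[of l]
  by auto

text \<open>A sign change along \<open>l\<close> would produce a zero on \<open>l\<close>, which
  inside the closed disk is a point of \<open>l'\<close>.\<close>

lemma chord_side_same_side:
  assumes "l \<in> S" "l' \<in> S" "l \<noteq> l'" "x \<in> l" "y \<in> l"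
  shows "chord_side l' x * chord_side l' y > 0"
proof (rule ccontr)
  assume "\<not> chord_side l' x * chord_side l' y > 0"
  then obtain w where w: "w \<in> closed_segment x y" "chord_side l' w = 0"
    using side_zero_on_segment unfolding chord_side_def by (metis not_less)
  then have "w \<in> l"
    using assms convex_chord by (meson closed_segment_subset subsetD)
  then show False
    using w assms chord_side_eq_0_iff[of l' w] chords_disjoint[of l l'] chord_subset_cball[of l w] by auto
qed

definition chord_mid :: "complex set \<Rightarrow> complex" where
  "chord_mid l = midpoint (a l) (b l)"

lemma chord_mid_in: "l \<in> S \<Longrightarrow> chord_mid l \<in> l"
  using chord_eq[of l] unfolding chord_mid_def by (metis midpoint_in_closed_segment)

lemma chord_mid_in_ball: assumes "l \<in> S" shows "chord_mid l \<in> ball 0 1"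
proof -
  have "chord_mid l \<in> open_segment (a l) (b l)"
    using ends_neq[OF assms] by (simp add: chord_mid_def)
  then have "norm (chord_mid l) < norm (a l) \<or> norm (chord_mid l) < norm (b l)"
    using dist_decreases_open_segment[of _ "a l" "b l" 0] by (auto simp: dist_norm)
  then show ?thesis
    using norm_ends assms by auto
qed

section \<open>Complementary regions as sign cells\<close>

abbreviation portrait :: "complex set set" where
  "portrait \<equiv> sibling_portrait S"

lemma chord_side_nonzero: "z \<in> ball 0 1 - \<Union> S \<Longrightarrow> l \<in> S \<Longrightarrow> chord_side l z \<noteq> 0"
  using chord_side_eq_0_iff[of l z] by auto

text \<open>Products compare signs with those at \<open>z\<close> without a choice of sign vector.
  For \<open>z\<close> in the open disk off the leaves this is the component of
  \<open>z\<close>.\<close>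

definition cell :: "complex \<Rightarrow> complex set" where
  "cell z = {w \<in> ball 0 1. \<forall>l\<in>S. chord_side l z * chord_side l w > 0}"

lemma chord_side_convex_comb_pos:
  assumes "chord_side l z * chord_side l x > 0" "chord_side l z * chord_side l y \<ge> 0" "0 \<le> t" "t < 1"
  shows "chord_side l z * chord_side l ((1 - t) *\<^sub>R x + t *\<^sub>R y) > 0"
proof -
  have "chord_side l z * chord_side l ((1 - t) *\<^sub>R x + t *\<^sub>R y) =
      (1 - t) * (chord_side l z * chord_side l x) + t * (chord_side l z * chord_side l y)"
    unfolding chord_side_affine by (simp add: algebra_simps)
  also have "\<dots> > 0"
    using assms by (intro add_pos_nonneg) auto
  finally show ?thesis .
qed

lemma convex_cell: "convex (cell z)"
proof (rule convexI)
  fix x y and u v :: real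
  assume xy: "x \<in> cell z" "y \<in> cell z" "0 \<le> u" "0 \<le> v" "u + v = 1"
  have "u *\<^sub>R x + v *\<^sub>R y \<in> ball 0 1"
    using xy by (intro convexD[OF convex_ball]) (auto simp: cell_def)
  moreover have "chord_side l z * chord_side l (u *\<^sub>R x + v *\<^sub>R y) > 0" if "l \<in> S" for l
  proof (cases "v = 1")
    case True
    then show ?thesis using xy that by (simp add: cell_def)
  next
    case False
    then show ?thesis
      using chord_side_convex_comb_pos[of l z x y v] xy that
      by (auto simp: cell_def less_imp_le eq_diff_eq[symmetric])
  qed
  ultimately show "u *\<^sub>R x + v *\<^sub>R y \<in> cell z"
    by (simp add: cell_def)
qed

lemma open_cell: "open (cell z)"
proof -
  have "cell z = ball 0 1 \<inter> (\<Inter>l\<in>S. {w. 0 < chord_side l z * chord_side l w})"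
    by (auto simp: cell_def)
  also have "open \<dots>"
    using finite_S by (intro open_Int open_ball open_INT ballI open_Collect_less continuous_intros) auto
  finally show ?thesis .
qed

lemma cell_subset: "cell z \<subseteq> ball 0 1 - \<Union> S"
proof
  fix w assume w: "w \<in> cell z"
  then have "norm w \<le> 1" by (auto simp: cell_def)
  then show "w \<in> ball 0 1 - \<Union> S"
    using w chord_side_eq_0_iff[of _ w] by (force simp: cell_def)
qed

lemma self_in_cell: "z \<in> ball 0 1 - \<Union> S \<Longrightarrow> z \<in> cell z"
  using chord_side_nonzero[of z] by (auto simp: cell_def zero_less_mult_iff not_less_iff_gr_or_eq)

text \<open>A cell is convex, hence connected, and a connected set that avoids the leaves keeps the
  sign of every affine function by the intermediate value theorem.\<close>

lemma cell_in_portrait: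
  assumes "z \<in> ball 0 1 - \<Union> S"
  shows "cell z \<in> portrait"
proof -
  have "connected_component_set (ball 0 1 - \<Union> S) z = cell z"
  proof (rule connected_component_unique)
    fix C assume C: "z \<in> C" "C \<subseteq> ball 0 1 - \<Union> S" "connected C"
    show "C \<subseteq> cell z"
    proof
      fix w assume w: "w \<in> C"
      have "chord_side l z * chord_side l w > 0" if l: "l \<in> S" for l
      proof -
        have conn: "connected (chord_side l ` C)"
          using C by (intro connected_continuous_image continuous_intros)
        have nz: "chord_side l x \<noteq> 0" if "x \<in> C" for x
          using C chord_side_nonzero[OF _ l] that by blast
        have "\<not> (chord_side l x \<le> 0 \<and> 0 \<le> chord_side l y)" if "x \<in> C" "y \<in> C" for x y
          using connectedD_interval[OF conn imageI[OF that(1)] imageI[OF that(2)], of 0] nz by force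
        then have "chord_side l z \<noteq> 0" "chord_side l w \<noteq> 0" "\<not> (chord_side l z \<le> 0 \<and> 0 \<le> chord_side l w)"
            "\<not> (chord_side l w \<le> 0 \<and> 0 \<le> chord_side l z)"
          using C(1) w nz by blast+
        then show ?thesis by (auto simp: zero_less_mult_iff)
      qed
      then show "w \<in> cell z"
        using C w by (auto simp: cell_def)
    qed
  qed (use self_in_cell[OF assms] cell_subset convex_connected[OF convex_cell] in auto)
  then show ?thesis
    using assms unfolding sibling_portrait_def components_iff by blast
qed

lemma portrait_eq_cell:
  assumes "R \<in> portrait" "z \<in> R"
  shows "R = cell z" "z \<in> ball 0 1 - \<Union> S"
proof -
  show z: "z \<in> ball 0 1 - \<Union> S"
    using assms in_components_subset unfolding sibling_portrait_def by blast
  show "R = cell z"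
    using assms cell_in_portrait[OF z] self_in_cell[OF z] components_nonoverlap
    unfolding sibling_portrait_def by (metis disjoint_iff)
qed

lemma portrait_nonempty: "R \<in> portrait \<Longrightarrow> R \<noteq> {}"
  unfolding sibling_portrait_def by (rule in_components_nonempty)

lemma portrait_eqI: "R \<in> portrait \<Longrightarrow> R' \<in> portrait \<Longrightarrow> z \<in> R \<Longrightarrow> z \<in> R' \<Longrightarrow> R = R'"
  using portrait_eq_cell by metis

lemma convex_region: "R \<in> portrait \<Longrightarrow> convex R"
  using portrait_nonempty portrait_eq_cell convex_cell by (metis ex_in_conv)

lemma open_region: "R \<in> portrait \<Longrightarrow> open R"
  using portrait_nonempty portrait_eq_cell open_cell by (metis ex_in_conv)

text \<open>The weak inequalities are closed conditions. Conversely, the open segment from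
  \<open>z\<close> to a point that satisfies them runs inside the cell.\<close>

lemma closure_cell:
  assumes "z \<in> ball 0 1 - \<Union> S"
  shows "closure (cell z) = {w \<in> cball 0 1. \<forall>l\<in>S. chord_side l z * chord_side l w \<ge> 0}" (is "_ = ?K")
proof
  have "?K = cball 0 1 \<inter> (\<Inter>l\<in>S. {w. 0 \<le> chord_side l z * chord_side l w})"
    by auto
  also have "closed \<dots>"
    by (intro closed_Int closed_cball closed_INT ballI closed_Collect_le continuous_intros)
  finally show "closure (cell z) \<subseteq> ?K"
    by (rule closure_minimal[rotated]) (auto simp: cell_def less_imp_le)
  show "?K \<subseteq> closure (cell z)"
  proof
    fix w assume w: "w \<in> ?K"
    have zz: "z \<in> cell z" using self_in_cell assms .
    have "open_segment z w \<subseteq> cell z"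
    proof
      fix x assume "x \<in> open_segment z w"
      then obtain t where t: "0 < t" "t < 1" "x = (1 - t) *\<^sub>R z + t *\<^sub>R w"
        by (auto simp: in_segment)
      have "norm x \<le> (1 - t) * norm z + t * norm w"
        unfolding t using t norm_triangle_ineq[of "(1 - t) *\<^sub>R z" "t *\<^sub>R w"] by simp
      also have "\<dots> < (1 - t) * 1 + t * 1"
        using t w assms by (intro add_less_le_mono mult_strict_left_mono mult_left_mono) auto
      finally have "x \<in> ball 0 1" by simp
      moreover have "chord_side l z * chord_side l x > 0" if "l \<in> S" for l
        unfolding t using zz w t that by (intro chord_side_convex_comb_pos) (auto simp: cell_def)
      ultimately show "x \<in> cell z" by (simp add: cell_def)
    qed
    then have "closure (open_segment z w) \<subseteq> closure (cell z)"
      by (rule closure_mono)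
    then show "w \<in> closure (cell z)"
      using zz closure_subset by (cases "z = w") auto
  qed
qed

lemma closure_region:
  assumes "R \<in> portrait" "z \<in> R"
  shows "w \<in> closure R \<longleftrightarrow> norm w \<le> 1 \<and> (\<forall>l\<in>S. chord_side l z * chord_side l w \<ge> 0)"
  using portrait_eq_cell[OF assms] closure_cell[of z] by auto

section \<open>Leaves on the frontier of a region\<close>

lemma frontier_region: "R \<in> portrait \<Longrightarrow> frontier R = closure R - R"
  using open_region by (simp add: frontier_def interior_open)

lemma chord_not_in_region: "R \<in> portrait \<Longrightarrow> l \<in> S \<Longrightarrow> x \<in> l \<Longrightarrow> x \<notin> R"
  using portrait_eq_cell by blast

text \<open>A point of \<open>l\<close> lies on no other leaf, so the weak inequalities of the
  closure become strict for every leaf but \<open>l\<close>.\<close>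

lemma closure_region_strict:
  assumes "R \<in> portrait" "z \<in> R" "l \<in> S" "x \<in> l" "x \<in> closure R" "l' \<in> S" "l' \<noteq> l"
  shows "chord_side l' z * chord_side l' x > 0"
proof -
  have "chord_side l' z \<noteq> 0" using chord_side_nonzero portrait_eq_cell assms by blast
  moreover have "chord_side l' x \<noteq> 0"
    using chord_side_eq_0_iff[of l' x] chords_disjoint[of l l'] chord_subset_cball[of l x] assms by auto
  ultimately show ?thesis
    using assms closure_region[OF assms(1,2)] by (metis less_eq_real_def mult_eq_0_iff)
qed

text \<open>Every other leaf has all of \<open>l\<close> on one side, so a single point
  \<open>x\<close> decides for the whole leaf.\<close>

lemma adjacent_iff:
  assumes "R \<in> portrait" "z \<in> R" "l \<in> S" "x \<in> l"
  shows "l \<subseteq> frontier R \<longleftrightarrow> (\<forall>l'\<in>S - {l}. chord_side l' z * chord_side l' x > 0)"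
proof
  assume "l \<subseteq> frontier R"
  then have x: "x \<in> closure R" using assms by (auto simp: frontier_def)
  then show "\<forall>l'\<in>S - {l}. chord_side l' z * chord_side l' x > 0"
    using closure_region_strict assms by blast
next
  assume *: "\<forall>l'\<in>S - {l}. chord_side l' z * chord_side l' x > 0"
  have "y \<in> closure R" if "y \<in> l" for y
    unfolding closure_region[OF assms(1,2)]
  proof (intro conjI ballI)
    show "norm y \<le> 1" using chord_subset_cball assms that by blast
    fix l' assume l': "l' \<in> S"
    show "chord_side l' z * chord_side l' y \<ge> 0"
    proof (cases "l' = l")
      case True
      then show ?thesis using chord_side_eq_0_iff[of l y] assms that chord_subset_cball[of l y] by simp
    next
      case False
      then have "chord_side l' x * chord_side l' y > 0" "chord_side l' z * chord_side l' x > 0"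
        using chord_side_same_side[of l l' x y] * l' assms that by auto
      then show ?thesis by (auto simp: zero_less_mult_iff zero_le_mult_iff)
    qed
  qed
  then show "l \<subseteq> frontier R"
    using frontier_region[OF assms(1)] chord_not_in_region assms by auto
qed

lemma adjacentI:
  assumes "R \<in> portrait" "l \<in> S" "x \<in> l" "x \<in> closure R"
  shows "l \<subseteq> frontier R"
proof -
  obtain z where z: "z \<in> R" using portrait_nonempty assms by blast
  then have "\<forall>l'\<in>S - {l}. chord_side l' z * chord_side l' x > 0"
    using closure_region_strict assms by blast
  then show ?thesis using adjacent_iff[OF assms(1) z assms(2,3)] by blast
qed

text \<open>The segment from \<open>z\<close> to \<open>w\<close> meets the frontier of
  \<open>R\<close> inside the disk, where some affine function vanishes. The product is allowed to
  be zero since \<open>w\<close> may lie on that leaf.\<close>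

lemma exit_chord:
  assumes "R \<in> portrait" "z \<in> R" "w \<in> ball 0 1" "w \<notin> R"
  obtains l where "l \<in> S" "l \<subseteq> frontier R" "chord_side l z * chord_side l w \<le> 0"
proof -
  have "closed_segment z w \<inter> frontier R \<noteq> {}"
    using assms by (intro connected_Int_frontier) auto
  then obtain x where x: "x \<in> closed_segment z w" "x \<in> closure R" "x \<notin> R"
    using frontier_region[OF assms(1)] by auto
  then obtain t where t: "0 \<le> t" "t \<le> 1" "x = (1 - t) *\<^sub>R z + t *\<^sub>R w"
    by (auto simp: in_segment)
  have "closed_segment z w \<subseteq> ball 0 1"
    using assms(3) portrait_eq_cell(2)[OF assms(1,2)] by (intro closed_segment_subset) auto
  with x have xb: "x \<in> ball 0 1" by blast
  with x obtain l where l: "l \<in> S" "\<not> chord_side l z * chord_side l x > 0"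
    using portrait_eq_cell[OF assms(1,2)] by (auto simp: cell_def)
  have nz: "chord_side l z \<noteq> 0" using chord_side_nonzero portrait_eq_cell assms l by blast
  have "chord_side l z * chord_side l x \<ge> 0" using x closure_region[OF assms(1,2)] l by blast
  with l nz have 0: "chord_side l x = 0" by (metis less_eq_real_def mult_eq_0_iff)
  then have "x \<in> l" using chord_side_eq_0_iff[of l x] l xb by auto
  then have "l \<subseteq> frontier R" using adjacentI assms l x by blast
  moreover have "chord_side l z * chord_side l w \<le> 0"
  proof (rule ccontr)
    assume "\<not> ?thesis"
    then have w: "chord_side l z * chord_side l w > 0" by simp
    then have "x \<noteq> w" using 0 by auto
    then have "t < 1" using t by (cases "t = 1") auto
    moreover have "chord_side l z * chord_side l z > 0" using nz by (metis not_real_square_gt_zero)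
    ultimately have "chord_side l z * chord_side l x > 0"
      unfolding t using w t by (intro chord_side_convex_comb_pos) auto
    with 0 show False by simp
  qed
  ultimately show ?thesis using that l by blast
qed

lemma adjacent_chord_exists:
  assumes "R \<in> portrait"
  obtains l where "l \<in> S" "l \<subseteq> frontier R"
proof -
  obtain z l where z: "z \<in> R" "l \<in> S" using portrait_nonempty assms S_nonempty by blast
  then show ?thesis
    using exit_chord[OF assms z(1) chord_mid_in_ball[OF z(2)]] chord_not_in_region[OF assms z(2) chord_mid_in] that
    by blast
qed

text \<open>Small steps from the midpoint of \<open>l\<close> along both normals cross no other leaf
  and end on the two sides of \<open>l\<close>.\<close>

lemma adjacent_regions:
  assumes "l \<in> S"
  obtains z w where "z \<in> ball 0 1 - \<Union> S" "w \<in> ball 0 1 - \<Union> S" "chord_side l z > 0" "chord_side l w < 0"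
    "l \<subseteq> frontier (cell z)" "l \<subseteq> frontier (cell w)"
proof -
  define m where "m = chord_mid l"
  \<comment> \<open>A neighbourhood of the midpoint in which the signs at all other leaves are
    constant.\<close>
  define U where "U = {w \<in> ball 0 1. \<forall>l'\<in>S - {l}. chord_side l' m * chord_side l' w > 0}"
  have m: "m \<in> l" "m \<in> ball 0 1" using chord_mid_in chord_mid_in_ball assms by (simp_all add: m_def)
  have "U = ball 0 1 \<inter> (\<Inter>l'\<in>S - {l}. {w. 0 < chord_side l' m * chord_side l' w})"
    by (auto simp: U_def)
  also have "open \<dots>"
    using finite_S by (intro open_Int open_ball open_INT ballI open_Collect_less continuous_intros) auto
  finally have "open U" .
  moreover have "m \<in> U"
    using chord_side_same_side[OF assms _ _ m(1) m(1)] m by (auto simp: U_def)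
  ultimately obtain e where e: "e > 0" "cball m e \<subseteq> U"
    by (auto simp: open_contains_cball)
  \<comment> \<open>The left normal of the chord, along which its affine function grows.\<close>
  define n where "n = \<i> * (b l - a l)"
  have n: "norm n > 0" using ends_neq[OF assms] by (simp add: n_def norm_mult)
  have sdm: "chord_side l (m + r *\<^sub>R n) = r * (norm n)\<^sup>2" for r
  proof -
    have "chord_side l (m + r *\<^sub>R n) = chord_side l m + r * Im (n * cnj (b l - a l))"
      by (simp add: chord_side_def side_def algebra_simps)
    also have "Im (n * cnj (b l - a l)) = (norm (b l - a l))\<^sup>2"
      by (simp only: n_def cmod_power2) (simp add: power2_eq_square algebra_simps)
    also have "chord_side l m = 0"
      using chord_side_eq_0_iff assms m by auto
    finally show ?thesis by (simp add: n_def norm_mult)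
  qed
  have *: "z \<in> ball 0 1 - \<Union> S" "l \<subseteq> frontier (cell z)" if "z \<in> U" "chord_side l z \<noteq> 0" for z
  proof -
    have z: "z \<in> ball 0 1" "\<And>l'. l' \<in> S - {l} \<Longrightarrow> chord_side l' m * chord_side l' z > 0"
      using that(1) by (simp_all add: U_def)
    have "z \<notin> l'" if "l' \<in> S" for l'
    proof -
      have "chord_side l' z \<noteq> 0"
        using z(2)[of l'] \<open>chord_side l z \<noteq> 0\<close> that by (cases "l' = l") auto
      then show ?thesis
        using chord_side_eq_0_iff[OF that, of z] z(1) by simp
    qed
    then show zS: "z \<in> ball 0 1 - \<Union> S"
      using z(1) by blast
    have "\<forall>l'\<in>S - {l}. chord_side l' z * chord_side l' m > 0"
      using z(2) by (simp add: mult.commute)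
    then show "l \<subseteq> frontier (cell z)"
      using adjacent_iff[OF cell_in_portrait[OF zS] self_in_cell[OF zS] assms m(1)] by blast
  qed
  \<comment> \<open>Both points have distance exactly \<open>e\<close> from the midpoint, hence the
    closed ball above.\<close>
  have U: "m + (e / norm n) *\<^sub>R n \<in> U" "m + (- e / norm n) *\<^sub>R n \<in> U"
    using e(1) n by (auto intro!: subsetD[OF e(2)] simp: dist_norm)
  have sgn: "chord_side l (m + (e / norm n) *\<^sub>R n) > 0" "chord_side l (m + (- e / norm n) *\<^sub>R n) < 0"
    unfolding sdm using e(1) n by (auto simp: divide_neg_pos mult_neg_pos)
  then have nz: "chord_side l (m + (e / norm n) *\<^sub>R n) \<noteq> 0" "chord_side l (m + (- e / norm n) *\<^sub>R n) \<noteq> 0"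
    by auto
  show ?thesis
    by (rule that[OF *(1)[OF U(1) nz(1)] *(1)[OF U(2) nz(2)] sgn *(2)[OF U(1) nz(1)] *(2)[OF U(2) nz(2)]])
qed

subsection \<open>The dual graph\<close>

definition base_point :: "complex set \<Rightarrow> complex" where
  "base_point R = (SOME z. z \<in> R)"

text \<open>The sign is the same at all points of a region, see \<open>region_side_eq\<close>; the
  base point only makes it a function of the region.\<close>

definition region_side :: "complex set \<Rightarrow> complex set \<Rightarrow> real" where
  "region_side l R = sgn (chord_side l (base_point R))"

lemma base_point_in: "R \<in> portrait \<Longrightarrow> base_point R \<in> R"
  using portrait_nonempty unfolding base_point_def by (simp add: some_in_eq)

lemma region_side_cases: "R \<in> portrait \<Longrightarrow> l \<in> S \<Longrightarrow> region_side l R = 1 \<or> region_side l R = - 1"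
  using chord_side_nonzero[OF portrait_eq_cell(2)[OF _ base_point_in]] unfolding region_side_def
  by (metis linorder_neqE_linordered_idom sgn_neg sgn_pos)

lemma region_side_mult_pos:
  assumes "R \<in> portrait" "z \<in> R" "l \<in> S"
  shows "region_side l R * chord_side l w > 0 \<longleftrightarrow> chord_side l z * chord_side l w > 0"
    and "region_side l R * chord_side l w \<ge> 0 \<longleftrightarrow> chord_side l z * chord_side l w \<ge> 0"
proof -
  have "chord_side l (base_point R) * chord_side l z > 0"
    using portrait_eq_cell(1)[OF assms(1) base_point_in[OF assms(1)]] assms by (auto simp: cell_def)
  then show "region_side l R * chord_side l w > 0 \<longleftrightarrow> chord_side l z * chord_side l w > 0"
      "region_side l R * chord_side l w \<ge> 0 \<longleftrightarrow> chord_side l z * chord_side l w \<ge> 0"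
    unfolding region_side_def by (auto simp: zero_less_mult_iff zero_le_mult_iff sgn_if)
qed

lemma region_side_eq:
  assumes "R \<in> portrait" "z \<in> R" "l \<in> S"
  shows "region_side l R = sgn (chord_side l z)"
proof -
  have "chord_side l z * chord_side l z > 0"
    using chord_side_nonzero portrait_eq_cell assms by (metis not_real_square_gt_zero)
  then have "region_side l R * chord_side l z > 0"
    using region_side_mult_pos assms by blast
  then show ?thesis
    using region_side_cases[OF assms(1,3)] by (auto simp: sgn_if zero_less_mult_iff)
qed

lemma mem_region_iff:
  "R \<in> portrait \<Longrightarrow> w \<in> R \<longleftrightarrow> norm w < 1 \<and> (\<forall>l\<in>S. region_side l R * chord_side l w > 0)"
  using portrait_eq_cell(1)[OF _ base_point_in, of R] region_side_mult_pos(1)[OF _ base_point_in, of R] base_point_in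
  by (auto simp: cell_def)

lemma mem_closure_region_iff:
  "R \<in> portrait \<Longrightarrow> w \<in> closure R \<longleftrightarrow> norm w \<le> 1 \<and> (\<forall>l\<in>S. region_side l R * chord_side l w \<ge> 0)"
  using closure_region[OF _ base_point_in, of R] region_side_mult_pos(2)[OF _ base_point_in, of R] base_point_in
  by auto

lemma region_eqI:
  assumes "R \<in> portrait" "R' \<in> portrait" "\<And>l. l \<in> S \<Longrightarrow> region_side l R = region_side l R'"
  shows "R = R'"
  using mem_region_iff assms by (intro set_eqI) metis

text \<open>For a leaf other than \<open>l\<close>, both regions lie on the side on which
  \<open>l\<close> lies. Distinct regions differ in some sign, and only the one at \<open>l\<close>
  is left.\<close>

lemma region_side_across:
  assumes "R \<in> portrait" "R' \<in> portrait" "R \<noteq> R'" "l \<in> S" "l \<subseteq> frontier R" "l \<subseteq> frontier R'" "l' \<in> S"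
  shows "region_side l' R' = (if l' = l then - region_side l' R else region_side l' R)"
proof -
  have same: "region_side k R' = region_side k R" if k: "k \<in> S - {l}" for k
  proof -
    have "chord_side k (base_point R) * chord_side k (a l) > 0" "chord_side k (base_point R') * chord_side k (a l) > 0"
      using adjacent_iff[OF _ base_point_in assms(4) ends_in(1)] assms k by blast+
    then show ?thesis
      unfolding region_side_def by (auto simp: sgn_if zero_less_mult_iff)
  qed
  have "region_side l R' \<noteq> region_side l R"
    using region_eqI[OF assms(1,2)] same assms(3) by (metis DiffI singletonD)
  then have "region_side l R' = - region_side l R"
    using region_side_cases[OF assms(1,4)] region_side_cases[OF assms(2,4)] by auto
  then show ?thesis using same assms by auto
qed

text \<open>The regions found by stepping off the leaf are all there are: a third one would need a
  sign at \<open>l\<close> opposite to both \<open>1\<close> and \<open>- 1\<close>.\<close>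

lemma ends_of_leaf:
  assumes "l \<in> S"
  obtains R R' where "{R \<in> portrait. l \<subseteq> frontier R} = {R, R'}" "region_side l R = 1" "region_side l R' = - 1"
proof -
  obtain z w where zw: "z \<in> ball 0 1 - \<Union> S" "w \<in> ball 0 1 - \<Union> S" "chord_side l z > 0" "chord_side l w < 0"
    "l \<subseteq> frontier (cell z)" "l \<subseteq> frontier (cell w)"
    using adjacent_regions[OF assms] by metis
  let ?R = "cell z" and ?R' = "cell w"
  have R: "?R \<in> portrait" "?R' \<in> portrait"
    using zw cell_in_portrait by auto
  have region_side: "region_side l ?R = 1" "region_side l ?R' = - 1"
    using region_side_eq[OF R(1) self_in_cell] region_side_eq[OF R(2) self_in_cell] zw assms by auto
  have "Q = ?R \<or> Q = ?R'" if Q: "Q \<in> portrait" "l \<subseteq> frontier Q" for Q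
  proof (rule ccontr)
    assume "\<not> ?thesis"
    then have "region_side l Q = - region_side l ?R" "region_side l Q = - region_side l ?R'"
      using region_side_across[OF R(1) Q(1) _ assms zw(5) Q(2) assms]
        region_side_across[OF R(2) Q(1) _ assms zw(6) Q(2) assms] by auto
    then show False using region_side by simp
  qed
  then have "{R \<in> portrait. l \<subseteq> frontier R} = {?R, ?R'}"
    using R zw by auto
  with region_side show ?thesis using that by blast
qed

lemma dual_graph_simps [simp]:
  "mverts (dual_graph S) = portrait" "medges (dual_graph S) = S"
  "mends (dual_graph S) l = {R \<in> portrait. l \<subseteq> frontier R}"
  by (simp_all add: dual_graph_def)

lemma region_side_edge:
  assumes "l \<in> S" "mends (dual_graph S) l = {R, R'}" "l' \<in> S"
  shows "region_side l' R' = (if l' = l then - region_side l' R else region_side l' R)"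
proof -
  obtain Q Q' where Q: "{R, R'} = {Q, Q'}" "region_side l Q = 1" "region_side l Q' = - 1"
    using ends_of_leaf[OF assms(1)] assms(2) by (metis dual_graph_simps(3))
  have "R \<noteq> R'"
  proof
    assume "R = R'"
    with Q(1) have "Q = Q'" by auto
    with Q show False by simp
  qed
  moreover have "R \<in> portrait" "R' \<in> portrait" "l \<subseteq> frontier R" "l \<subseteq> frontier R'"
    using assms(2) by auto
  ultimately show ?thesis
    using region_side_across assms by blast
qed

lemma wf_dual_graph: "wf_multigraph (dual_graph S)"
  unfolding wf_multigraph_def
proof (intro ballI conjI)
  fix l assume "l \<in> medges (dual_graph S)"
  then have "l \<in> S" by simp
  then obtain R R' where "{R \<in> portrait. l \<subseteq> frontier R} = {R, R'}"
    by (rule ends_of_leaf)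
  then show "card (mends (dual_graph S) l) \<in> {1, 2}"
    by (simp add: card_insert_if)
qed auto

text \<open>Some leaf on the frontier of \<open>R\<close> separates it from the target
  \<open>R'\<close>, and crossing it lowers the number of separating leaves by one.\<close>

lemma connected_dual_graph: "mconnected (dual_graph S)"
proof -
  have walk: "\<exists>vs es. mwalk (dual_graph S) vs es \<and> hd vs = R \<and> last vs = R'"
    if "R \<in> portrait" "R' \<in> portrait" "card {l \<in> S. region_side l R \<noteq> region_side l R'} = n" for R R' n
    using that
  proof (induction n arbitrary: R)
    case 0
    then have "{l \<in> S. region_side l R \<noteq> region_side l R'} = {}"
      using finite_S by simp
    then have "R = R'"
      using 0 region_eqI by blast
    then show ?case
      using 0 by (intro exI[of _ "[R]"] exI[of _ "[]"]) (simp add: mwalk_def)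
  next
    case (Suc n)
    then have "R \<noteq> R'" by auto
    then have "base_point R' \<notin> R" "base_point R' \<in> ball 0 1"
      using Suc.prems portrait_eqI base_point_in portrait_eq_cell(2) by blast+
    then obtain l where l: "l \<in> S" "l \<subseteq> frontier R" "chord_side l (base_point R) * chord_side l (base_point R') \<le> 0"
      using exit_chord Suc.prems base_point_in by metis
    have "region_side l R * region_side l R' \<le> 0"
      using l(3) unfolding region_side_def by (simp flip: sgn_mult)
    then have diff: "region_side l R' = - region_side l R"
      using region_side_cases[of R l] region_side_cases[of R' l] Suc.prems l by auto
    obtain Q where Q: "mends (dual_graph S) l = {R, Q}"
    proof -
      obtain Q Q' where "mends (dual_graph S) l = {Q, Q'}"
        using ends_of_leaf[OF l(1)] by (metis dual_graph_simps(3))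
      moreover have "R \<in> mends (dual_graph S) l"
        using Suc.prems l by simp
      ultimately show ?thesis
        using that[of Q] that[of Q'] by (auto simp: insert_commute)
    qed
    then have "Q \<in> portrait" by auto
    have "region_side k Q \<noteq> region_side k R' \<longleftrightarrow> k \<noteq> l \<and> region_side k R \<noteq> region_side k R'" if "k \<in> S" for k
      using region_side_edge[OF l(1) Q that] diff by auto
    then have "{k \<in> S. region_side k Q \<noteq> region_side k R'} = {k \<in> S. region_side k R \<noteq> region_side k R'} - {l}"
      by blast
    moreover have "l \<in> {k \<in> S. region_side k R \<noteq> region_side k R'}"
      using l diff region_side_cases[of R l] Suc.prems by auto
    ultimately have "card {k \<in> S. region_side k Q \<noteq> region_side k R'} = n"
      using Suc.prems finite_S by simp
    then obtain vs es where w: "mwalk (dual_graph S) vs es" "hd vs = Q" "last vs = R'"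
      using Suc.IH[OF \<open>Q \<in> portrait\<close>] Suc.prems by blast
    then obtain vs' where vs: "vs = Q # vs'"
      by (cases vs) (auto simp: mwalk_def)
    have "mwalk (dual_graph S) (R # vs) (l # es)"
      using w Q l Suc.prems unfolding mwalk_def vs
      by (auto simp: nth_Cons split: nat.splits simp del: dual_graph_simps(3))
    then show ?case
      using w vs by (intro exI[of _ "R # vs"] exI[of _ "l # es"]) auto
  qed
  obtain l where "l \<in> S" using S_nonempty by blast
  then have "portrait \<noteq> {}"
    using adjacent_regions cell_in_portrait by (metis empty_iff)
  then show ?thesis
    using walk unfolding mconnected_def by auto
qed

lemma region_side_walk:
  assumes "mwalk (dual_graph S) vs es" "l \<in> S" "l \<notin> set es"
  shows "region_side l (last vs) = region_side l (hd vs)"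
  using assms
proof (induction es arbitrary: vs)
  case Nil
  then show ?case by (cases vs) (auto simp: mwalk_def)
next
  case (Cons e es)
  then obtain R vs' where vs: "vs = R # vs'" "length vs' = Suc (length es)"
    by (cases vs) (auto simp: mwalk_def)
  then obtain Q vs'' where vs': "vs' = Q # vs''" by (cases vs') auto
  have step: "mends (dual_graph S) ((e # es) ! i) = {vs ! i, vs ! Suc i}" if "i < Suc (length es)" for i
    using Cons.prems(1) that by (simp add: mwalk_def)
  have "mwalk (dual_graph S) vs' es"
    using Cons.prems(1) vs step[of "Suc _"] by (auto simp: mwalk_def simp del: dual_graph_simps(3))
  then have "region_side l (last vs') = region_side l (hd vs')"
    using Cons by simp
  moreover have "region_side l Q = region_side l R"
    using region_side_edge[of e R Q l] step[of 0] Cons.prems vs vs' by (auto simp: mwalk_def simp del: dual_graph_simps(3))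
  ultimately show ?case using vs vs' by simp
qed

text \<open>The first edge of a cycle flips the sign at its own leaf, and the remaining edges, being
  different leaves, cannot flip it back. A loop is the case without remaining edges.\<close>

lemma acyclic_dual_graph: "\<not> mcycle (dual_graph S) vs es"
proof
  assume c: "mcycle (dual_graph S) vs es"
  then obtain e es' where es: "es = e # es'" "e \<notin> set es'"
    unfolding mcycle_def by (cases es) auto
  have w: "mwalk (dual_graph S) vs es" "hd vs = last vs"
    using c by (auto simp: mcycle_def)
  then obtain R vs' where vs: "vs = R # vs'" "length vs' = Suc (length es')"
    using es by (cases vs) (auto simp: mwalk_def)
  then obtain Q vs'' where vs': "vs' = Q # vs''" by (cases vs') auto
  have e: "e \<in> S" using w es by (simp add: mwalk_def)
  have step: "mends (dual_graph S) ((e # es') ! i) = {vs ! i, vs ! Suc i}" if "i < Suc (length es')" for i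
    using w that es by (simp add: mwalk_def)
  have "mwalk (dual_graph S) vs' es'"
    using w(1) vs es step[of "Suc _"] by (auto simp: mwalk_def simp del: dual_graph_simps(3))
  then have "region_side e (last vs') = region_side e Q"
    using region_side_walk e es vs' by fastforce
  moreover have "region_side e Q = - region_side e R"
    using region_side_edge[of e R Q e] step[of 0] e vs vs' by (auto simp del: dual_graph_simps(3))
  moreover have "last vs' = R"
    using w vs vs' by simp
  moreover have "R \<in> portrait"
    using w vs by (simp add: mwalk_def)
  ultimately show False
    using region_side_cases[OF _ e, of R] by auto
qed

lemma mtree_dual_graph: "mtree (dual_graph S)"
  using wf_dual_graph connected_dual_graph acyclic_dual_graph by (simp add: mtree_def)

text \<open>An edge runs straight from one base point to the midpoint of the leaf and on to the
  other base point. Each half stays in its region up to the midpoint, so two edges can meet only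
  inside a common region, where \<open>segments_to_frontier_Int\<close> leaves just the base
  point.\<close>

lemma planar_dual_graph: "planar (dual_graph S)"
proof -
  have "\<exists>R R'. {Q \<in> portrait. l \<subseteq> frontier Q} = {R, R'} \<and> R \<noteq> R'" if l: "l \<in> S" for l
  proof -
    obtain R R' where "{Q \<in> portrait. l \<subseteq> frontier Q} = {R, R'}" "region_side l R = 1" "region_side l R' = - 1"
      using ends_of_leaf[OF l] by blast
    moreover from this(2,3) have "R \<noteq> R'" by force
    ultimately show ?thesis by blast
  qed
  then have "\<forall>l\<in>S. \<exists>R R'. {Q \<in> portrait. l \<subseteq> frontier Q} = {R, R'} \<and> R \<noteq> R'"
    by blast
  \<comment> \<open>\<open>P l\<close> and \<open>N l\<close> name the two regions along
    \<open>l\<close> in an arbitrary order.\<close>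
  from bchoice[OF this] obtain P where
    "\<forall>l\<in>S. \<exists>R'. {Q \<in> portrait. l \<subseteq> frontier Q} = {P l, R'} \<and> P l \<noteq> R'" ..
  from bchoice[OF this] obtain N where
    PN: "\<forall>l\<in>S. {Q \<in> portrait. l \<subseteq> frontier Q} = {P l, N l} \<and> P l \<noteq> N l" ..
  have ends: "\<And>l. l \<in> S \<Longrightarrow> {Q \<in> portrait. l \<subseteq> frontier Q} = {P l, N l}"
    and neq: "\<And>l. l \<in> S \<Longrightarrow> P l \<noteq> N l"
    using PN by simp_all
  define crv where "crv l = linepath (base_point (P l)) (chord_mid l) +++ linepath (chord_mid l) (base_point (N l))" for l
  have reg: "P l \<in> portrait" "N l \<in> portrait" "l \<subseteq> frontier (P l)" "l \<subseteq> frontier (N l)" if "l \<in> S" for l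
    using ends[OF that] by blast+
  have mfr: "chord_mid l \<in> frontier R" if "l \<in> S" "R \<in> {P l, N l}" for l R
    using reg chord_mid_in that by blast
  have seg: "closed_segment (base_point R) (chord_mid l) \<subseteq> insert (chord_mid l) R" if "l \<in> S" "R \<in> {P l, N l}" for l R
  proof -
    have "R \<in> portrait" using reg that by blast
    then show ?thesis
      using mfr[OF that] by (intro segment_to_closure open_region convex_region base_point_in) (auto simp: frontier_def)
  qed
  have chord_mid_out: "chord_mid l \<notin> R" if "l \<in> S" "R \<in> portrait" for l R
    using chord_not_in_region chord_mid_in that by blast
  have im: "path_image (crv l) = closed_segment (base_point (P l)) (chord_mid l) \<union> closed_segment (base_point (N l)) (chord_mid l)" for l
    unfolding crv_def by (subst path_image_join) (auto simp: closed_segment_commute)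
  have disj: "R \<inter> R' = {}" if "R \<in> portrait" "R' \<in> portrait" "R \<noteq> R'" for R R'
    using portrait_eqI that by blast
  have "plane_drawing (dual_graph S) base_point crv"
    unfolding plane_drawing_def dual_graph_simps
  proof (intro conjI ballI impI)
    show "inj_on base_point portrait"
      using portrait_eqI base_point_in by (metis inj_onI)
  next
    fix l assume l: "l \<in> S"
    have "base_point (P l) \<noteq> chord_mid l" "chord_mid l \<noteq> base_point (N l)"
      using base_point_in reg[OF l] chord_mid_out[OF l] by metis+
    moreover have "closed_segment (base_point (P l)) (chord_mid l) \<inter> closed_segment (chord_mid l) (base_point (N l)) \<subseteq> {chord_mid l}"
      using seg[OF l, of "P l"] seg[OF l, of "N l"] disj[OF reg(1,2)[OF l] neq[OF l]]
      by (auto simp: closed_segment_commute)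
    ultimately have "arc (crv l)"
      unfolding crv_def by (intro arc_join arc_linepath) auto
    then show "simple_path (crv l)"
      by (rule arc_imp_simple_path)
    show "{pathstart (crv l), pathfinish (crv l)} = base_point ` {R \<in> portrait. l \<subseteq> frontier R}"
      unfolding ends[OF l] by (simp add: crv_def)
    show "path_image (crv l) \<inter> base_point ` portrait = base_point ` {R \<in> portrait. l \<subseteq> frontier R}"
    proof
      show "path_image (crv l) \<inter> base_point ` portrait \<subseteq> base_point ` {R \<in> portrait. l \<subseteq> frontier R}"
      proof
        fix x assume "x \<in> path_image (crv l) \<inter> base_point ` portrait"
        then obtain R where R: "x = base_point R" "R \<in> portrait" "x \<in> path_image (crv l)" by auto
        \<comment> \<open>A vertex on the curve is not the midpoint, which lies on a leaf, so it is
          in one of the two regions and must be the base point of that region.\<close>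
        then have "x \<in> insert (chord_mid l) (P l \<union> N l)"
          using seg[OF l, of "P l"] seg[OF l, of "N l"] unfolding im by auto
        then have "x \<in> P l \<or> x \<in> N l"
          using R(1) base_point_in[OF R(2)] chord_mid_out[OF l R(2)] by auto
        then have "R = P l \<or> R = N l"
          using portrait_eqI[OF R(2) reg(1)[OF l] base_point_in[OF R(2)]]
            portrait_eqI[OF R(2) reg(2)[OF l] base_point_in[OF R(2)]] R(1) by blast
        then show "x \<in> base_point ` {R \<in> portrait. l \<subseteq> frontier R}"
          unfolding ends[OF l] using R(1) by blast
      qed
      show "base_point ` {R \<in> portrait. l \<subseteq> frontier R} \<subseteq> path_image (crv l) \<inter> base_point ` portrait"
        unfolding ends[OF l] im using reg(1,2)[OF l] ends_in_segment(1) by blast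
    qed
  next
    fix l k assume l: "l \<in> S" and k: "k \<in> S" and lk: "l \<noteq> k"
    have mm: "chord_mid l \<noteq> chord_mid k"
      using chord_mid_in[OF l] chord_mid_in[OF k] chords_disjoint[OF l k lk] by auto
    show "path_image (crv l) \<inter> path_image (crv k) \<subseteq>
        base_point ` {R \<in> portrait. l \<subseteq> frontier R} \<inter> base_point ` {R \<in> portrait. k \<subseteq> frontier R}"
    proof
      fix x assume "x \<in> path_image (crv l) \<inter> path_image (crv k)"
      then obtain R Q where R: "R \<in> {P l, N l}" "x \<in> closed_segment (base_point R) (chord_mid l)"
        and Q: "Q \<in> {P k, N k}" "x \<in> closed_segment (base_point Q) (chord_mid k)"
        unfolding im by auto
      have RQ: "R \<in> portrait" "Q \<in> portrait"
        using R(1) Q(1) reg(1,2)[OF l] reg(1,2)[OF k] by blast+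
      have "x \<in> insert (chord_mid l) R" "x \<in> insert (chord_mid k) Q"
        using seg[OF l R(1)] seg[OF k Q(1)] R(2) Q(2) by blast+
      then have "x \<in> R" "x \<in> Q"
        using mm chord_mid_out[OF l RQ(2)] chord_mid_out[OF k RQ(1)] by auto
      then have "R = Q"
        using portrait_eqI[OF RQ] by blast
      then have "x = base_point R"
        using segments_to_frontier_Int[OF open_region convex_region base_point_in, OF RQ(1) RQ(1) RQ(1) mfr[OF l R(1)]]
          mfr[OF k Q(1)] mm R(2) Q(2) by blast
      then show "x \<in> base_point ` {R \<in> portrait. l \<subseteq> frontier R} \<inter> base_point ` {R \<in> portrait. k \<subseteq> frontier R}"
        unfolding ends[OF l] ends[OF k] using R Q \<open>R = Q\<close> by blast
    qed
  qed
  then show ?thesis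
    unfolding planar_def by blast
qed

subsection \<open>Boundary arcs\<close>

text \<open>No factor can vanish while the product is positive, so factors positive at
  \<open>s0\<close> remain so. At most one factor vanishes at \<open>s0\<close>, since the leaves
  are disjoint; its sign is then forced by the product.\<close>

lemma region_side_pos_along_arc:
  assumes R: "R \<in> portrait" and s0: "circ s0 \<in> closure R" and s: "s \<noteq> s0"
    and pos: "\<And>r. r \<in> closed_segment s0 s \<Longrightarrow> r \<noteq> s0 \<Longrightarrow> (\<Prod>l\<in>S. region_side l R * chord_side l (circ r)) > 0"
    and l: "l \<in> S"
  shows "region_side l R * chord_side l (circ s) > 0"
proof -
  define f where "f l r = region_side l R * chord_side l (circ r)" for l r
  have nonneg: "f l s0 \<ge> 0" if "l \<in> S" for l
    using mem_closure_region_iff[OF R] s0 that by (simp add: f_def)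
  have nz: "f l r \<noteq> 0" if "l \<in> S" "r \<in> closed_segment s0 s" "r \<noteq> s0" for l r
    using pos[OF that(2,3)] that(1) finite_S unfolding f_def by (metis less_irrefl prod_zero)
  have keep: "f l s > 0" if l: "l \<in> S" and "f l s0 \<noteq> 0" for l
  proof (rule ccontr)
    assume "\<not> f l s > 0"
    have "continuous_on (closed_segment s0 s) (f l)"
      unfolding f_def by (intro continuous_intros)
    then have "connected (f l ` closed_segment s0 s)"
      by (intro connected_continuous_image convex_connected convex_closed_segment)
    moreover have "f l s \<in> f l ` closed_segment s0 s" "f l s0 \<in> f l ` closed_segment s0 s"
      by (intro imageI ends_in_segment)+
    ultimately have "0 \<in> f l ` closed_segment s0 s"
      using \<open>\<not> f l s > 0\<close> nonneg[OF l] connectedD_interval[of _ "f l s" "f l s0" 0] by simp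
    then obtain r where "r \<in> closed_segment s0 s" "f l r = 0"
      by (metis imageE)
    then show False
      using nz[OF l, of r] that(2) by metis
  qed
  show ?thesis
  proof (cases "f l s0 = 0")
    case False
    then show ?thesis using keep[OF l] by (simp add: f_def)
  next
    case True
    have "circ s0 \<in> l"
      using True region_side_cases[OF R l] chord_side_eq_0_iff[OF l, of "circ s0"] by (auto simp: f_def)
    have "f k s > 0" if k: "k \<in> S - {l}" for k
    proof (rule keep)
      have "circ s0 \<notin> k"
        using \<open>circ s0 \<in> l\<close> chords_disjoint[of k l] k l by auto
      then show "f k s0 \<noteq> 0"
        using region_side_cases[OF R, of k] chord_side_eq_0_iff[of k "circ s0"] k by (auto simp: f_def)
    qed (use k in simp)
    then have "(\<Prod>k\<in>S - {l}. f k s) > 0"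
      by (rule prod_pos)
    moreover have "f l s * (\<Prod>k\<in>S - {l}. f k s) > 0"
      using pos[of s] s prod.remove[OF finite_S l, of "\<lambda>k. f k s"] by (simp add: f_def)
    ultimately show ?thesis
      by (simp add: f_def zero_less_mult_iff)
  qed
qed

lemma boundary_arcs_nonempty:
  assumes "R \<in> portrait"
  shows "boundary_arcs R \<noteq> {}"
proof -
  obtain l where l: "l \<in> S" "l \<subseteq> frontier R"
    using adjacent_chord_exists[OF assms] .
  then have "a l \<in> closure R \<inter> sphere 0 1"
    using ends_in[of l] norm_ends[of l] by (auto simp: frontier_def)
  then show ?thesis
    unfolding boundary_arcs_def by auto
qed

text \<open>All factors of the product are nonnegative on the closure of \<open>R\<close>, so \<open>R\<close> can only reach the
  preimages of the arc on which \<open>G\<close> is positive. \<open>G\<close> will be a multiple of the affine function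
  of the image leaf.\<close>

lemma boundary_arcs_cases:
  assumes R: "R \<in> portrait" and d: "d > 0" and h: "0 < h" "h < 1"
    and prod: "\<And>z. norm z = 1 \<Longrightarrow> (\<Prod>l\<in>S. region_side l R * chord_side l z) = G (z ^ d)"
    and pos: "\<And>t. u < t \<Longrightarrow> t < u + h \<Longrightarrow> G (circ t) > 0"
    and neg: "\<And>t. u + h < t \<Longrightarrow> t < u + 1 \<Longrightarrow> G (circ t) < 0"
    and A: "A \<in> boundary_arcs R"
  obtains i :: nat where "A = circ ` {(u + i) / d .. (u + i) / d + h / d}"
proof -
  \<comment> \<open>For \<open>i < d\<close> these are the \<open>d\<close> lifts under the power
    map of the arc from \<open>circ u\<close> to \<open>circ (u + h)\<close>.\<close>
  define E where "E i = circ ` {(u + real i) / d .. (u + real i) / d + h / d}" for i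
  let ?X = "closure R \<inter> sphere 0 1"
  have cover: "\<exists>i<d. x \<in> E i" if x: "x \<in> ?X" for x
  proof -
    obtain s where s: "u / d \<le> s" "s < u / d + 1" "x = circ s"
      using circ_surj_interval[of x "u / d"] x by auto
    \<comment> \<open>\<open>i\<close> is chosen so that \<open>d * s - i\<close> lies in the one
      full turn \<open>[u, u + 1)\<close>.\<close>
    define i where "i = nat \<lfloor>d * s - u\<rfloor>"
    have ds: "0 \<le> d * s - u" "d * s - u < d"
      using s d by (simp_all add: field_simps)
    then have i: "real i \<le> d * s - u" "d * s - u < real i + 1"
      by (simp_all add: i_def)
    have "(\<Prod>l\<in>S. region_side l R * chord_side l x) \<ge> 0"
      using mem_closure_region_iff[OF R] x by (intro prod_nonneg) auto
    moreover have "x ^ d = circ (d * s - i)"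
      using circ_add_int[of "d * s" "- int i"] s by (simp add: circ_power)
    ultimately have "\<not> G (circ (d * s - i)) < 0"
      using prod[of x] x by simp
    then have "d * s - i \<le> u + h"
      using neg[of "d * s - i"] i by linarith
    then have "s \<in> {(u + real i) / d .. (u + real i) / d + h / d}"
      using i d by (auto simp: field_simps)
    moreover have "i < d"
      using i ds d by linarith
    ultimately show ?thesis
      unfolding E_def s by blast
  qed
  \<comment> \<open>One point of \<open>E i\<close> in the closure of \<open>R\<close> pulls in the
    whole arc: the product is positive in its interior, so no sign changes there, and the two ends
    follow by continuity.\<close>
  have whole: "E i \<subseteq> ?X" if x: "x \<in> ?X" "x \<in> E i" for x i
  proof -
    define p q where "p = (u + real i) / d" and "q = (u + real i) / d + h / d"
    have pq: "p < q" using h d by (simp add: p_def q_def)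
    obtain s0 where s0: "p \<le> s0" "s0 \<le> q" "x = circ s0"
      using x by (auto simp: E_def p_def q_def)
    have prod_pos: "(\<Prod>l\<in>S. region_side l R * chord_side l (circ r)) > 0" if "p < r" "r < q" for r
    proof -
      have "u < d * r - i" "d * r - i < u + h"
        using that d by (auto simp: p_def q_def field_simps)
      moreover have "circ r ^ d = circ (d * r - i)"
        using circ_add_int[of "d * r" "- int i"] by (simp add: circ_power)
      ultimately show ?thesis
        using pos prod by simp
    qed
    have open_part: "region_side l R * chord_side l (circ s) \<ge> 0" if s: "p < s" "s < q" and l: "l \<in> S" for s l
    proof (cases "s = s0")
      case True
      then show ?thesis
        using mem_closure_region_iff[OF R] x s0 l by auto
    next
      case False
      have "(\<Prod>l\<in>S. region_side l R * chord_side l (circ r)) > 0" if "r \<in> closed_segment s0 s" "r \<noteq> s0" for r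
        using that s0 s False
        by (intro prod_pos) (auto simp: closed_segment_eq_real_ivl split: if_splits)
      then show ?thesis
        using region_side_pos_along_arc[OF R _ False, of l] x s0 l by fastforce
    qed
    have "region_side l R * chord_side l (circ s) \<ge> 0" if "p \<le> s" "s \<le> q" "l \<in> S" for s l
    proof -
      have "closed {s. 0 \<le> region_side l R * chord_side l (circ s)}"
        by (intro closed_Collect_le continuous_intros)
      then have "closure {p<..<q} \<subseteq> {s. 0 \<le> region_side l R * chord_side l (circ s)}"
        using open_part that by (intro closure_minimal) auto
      then show ?thesis
        using that pq by auto
    qed
    then show ?thesis
      using mem_closure_region_iff[OF R] by (auto simp: E_def p_def q_def)
  qed
  have disjoint: "E i \<inter> E j = {}" if ij: "i < d" "j < d" "i < j" for i j
  proof (rule ccontr)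
    assume "E i \<inter> E j \<noteq> {}"
    then obtain x where "x \<in> E i" "x \<in> E j"
      by blast
    then obtain s t where st: "s \<in> {(u + real i) / d .. (u + real i) / d + h / d}"
      "t \<in> {(u + real j) / d .. (u + real j) / d + h / d}" "circ t = circ s"
      unfolding E_def by auto
    then obtain k :: int where k: "t - s = of_int k"
      unfolding circ_eq_iff by (auto elim: Ints_cases)
    have "u + i \<le> d * s" "d * s \<le> u + i + h" "u + j \<le> d * t" "d * t \<le> u + j + h"
      using st d by (auto simp: field_simps)
    then have b: "real j - real i - h \<le> d * (t - s)" "d * (t - s) \<le> real j - real i + h"
      by (simp_all add: algebra_simps)
    \<comment> \<open>Since \<open>i < j < d\<close> and \<open>h < 1\<close>, the bounds put the
      integer \<open>t - s\<close> strictly between 0 and 1.\<close>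
    have "real i + 1 \<le> real j" "real j + 1 \<le> real d"
      using ij by linarith+
    then have "0 < real d * (t - s)" "real d * (t - s) < real d * 1"
      using b h by linarith+
    then have "0 < t - s" "t - s < 1"
      using d by (simp_all add: zero_less_mult_iff)
    then show False
      unfolding k by simp
  qed
  have disj: "E i \<inter> E j = {}" if "i < d" "j < d" "i \<noteq> j" for i j
    using disjoint[of i j] disjoint[of j i] that by (cases "i < j") auto
  have compact: "compact (E i)" for i
    unfolding E_def by (intro compact_continuous_image continuous_intros compact_Icc)
  have connected: "connected (E i)" for i
    unfolding E_def by (intro connected_continuous_image continuous_intros connected_Icc)
  have A': "A \<in> components ?X"
    using A by (simp add: boundary_arcs_def)
  then obtain x where x: "x \<in> A" "x \<in> ?X"
    using in_components_nonempty in_components_subset by blast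
  then obtain i where i: "i < d" "x \<in> E i"
    using cover by blast
  have "E i \<subseteq> A"
    using whole[OF x(2) i(2)] x i by (intro components_maximal[OF A' connected]) auto
  \<comment> \<open>The connected set \<open>A\<close> is covered by two disjoint closed sets,
    \<open>E i\<close> and the union of the other lifts; it meets the first and so misses the
    second.\<close>
  moreover have "A \<subseteq> E i"
  proof -
    let ?B = "\<Union>j\<in>{..<d} - {i}. E j"
    have "A \<subseteq> E i \<union> ?B"
      using cover in_components_subset[OF A'] by blast
    moreover have "E i \<inter> ?B \<inter> A = {}"
      using disj[OF i(1)] by blast
    moreover have "closed (E i)" "closed ?B"
      using compact by (auto intro!: compact_imp_closed)
    ultimately have "E i \<inter> A = {} \<or> ?B \<inter> A = {}"
      using in_components_connected[OF A'] by (intro connected_closedD) auto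
    then show ?thesis
      using x i \<open>A \<subseteq> E i \<union> ?B\<close> by blast
  qed
  ultimately show ?thesis
    using that[of i] by (simp add: E_def)
qed

end

section \<open>Full sibling collections\<close>

text \<open>The leaves are oriented consistently with the image leaf, so that the \<open>a l\<close>
  are roots of one number and the \<open>b l\<close> of another. \<open>h\<close> is the length of
  the image leaf; the strict upper bound excludes a diameter.\<close>

locale sibling_chords = disjoint_chords +
  fixes d :: nat and u h :: real
  assumes card_S: "card S = d"
    and h_bounds: "0 < h" "h < 1 / 2"
    and power_ends: "l \<in> S \<Longrightarrow> a l ^ d = circ u" "l \<in> S \<Longrightarrow> b l ^ d = circ (u + h)"
begin

section \<open>The ends as \<open>d\<close>-th roots and the product of the affine functions\<close>

lemma d_pos: "d > 0"
  using card_S finite_S S_nonempty by (simp add: card_gt_0_iff flip: card_S)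

text \<open>Disjoint leaves have distinct ends, so the \<open>d\<close> chosen ends exhaust the
  \<open>d\<close> roots of \<open>c\<close>.\<close>

lemma prod_end:
  fixes e :: "complex set \<Rightarrow> complex"
  assumes "\<And>l. l \<in> S \<Longrightarrow> e l \<in> l" "\<And>l. l \<in> S \<Longrightarrow> e l ^ d = c" "c \<noteq> 0"
  shows "e ` S = {w. w ^ d = c}" "(\<Prod>l\<in>S. z - e l) = z ^ d - c"
proof -
  have inj: "inj_on e S"
    using assms(1) chords_disjoint by (intro inj_onI) (metis disjoint_iff)
  have card: "card {w::complex. w ^ d = c} = d"
    using card_nth_roots[OF assms(3) d_pos] .
  then have "finite {w::complex. w ^ d = c}"
    using d_pos by (metis card.infinite less_irrefl)
  then show im: "e ` S = {w. w ^ d = c}"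
    using assms(2) card card_S card_image[OF inj] by (intro card_subset_eq) auto
  have "(\<Prod>l\<in>S. z - e l) = (\<Prod>w\<in>e ` S. z - w)"
    by (simp add: prod.reindex[OF inj])
  then show "(\<Prod>l\<in>S. z - e l) = z ^ d - c"
    unfolding im by (simp add: prod_nth_roots[OF assms(3) d_pos])
qed

text \<open>By \<open>side_circle\<close> the product has, up to a constant, numerator
  \<open>(z ^ d - circ u) * (z ^ d - circ (u + h))\<close> and denominator \<open>z ^ d\<close>.
  This is the same expression for the image leaf at \<open>z ^ d\<close>.\<close>

lemma prod_chord_side_eq_side:
  obtains C where "C \<noteq> 0"
    "\<And>z. norm z = 1 \<Longrightarrow> (\<Prod>l\<in>S. chord_side l z) = C * side (circ u) (circ (u + h)) (z ^ d)"
proof -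
  define K where "K = (\<Prod>l\<in>S. (a l - b l) / (2 * \<i> * a l * b l))"
  define k where "k = (circ u - circ (u + h)) / (2 * \<i> * circ u * circ (u + h))"
  define D where "D = K / k"
  have "circ u \<noteq> circ (u + h)"
    using h_bounds by (auto simp: circ_eq_iff elim!: Ints_cases)
  then have "k \<noteq> 0"
    using circ_nonzero by (simp add: k_def)
  moreover have "K \<noteq> 0"
    using finite_S ends_neq norm_ends by (fastforce simp: K_def)
  ultimately have D: "D \<noteq> 0"
    by (simp add: D_def)
  have eq: "of_real (\<Prod>l\<in>S. chord_side l z) = D * of_real (side (circ u) (circ (u + h)) (z ^ d))"
    if z: "norm z = 1" for z
  proof -
    have "of_real (\<Prod>l\<in>S. chord_side l z) = (\<Prod>l\<in>S. (a l - b l) / (2 * \<i> * a l * b l) * ((z - a l) * (z - b l) / z))"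
      using norm_ends z by (simp add: chord_side_def side_circle)
    also have "\<dots> = K * ((\<Prod>l\<in>S. z - a l) * (\<Prod>l\<in>S. z - b l) / z ^ d)"
      by (simp only: K_def prod.distrib prod_dividef prod_constant card_S)
    also have "\<dots> = K * ((z ^ d - circ u) * (z ^ d - circ (u + h)) / z ^ d)"
      using prod_end(2)[OF ends_in(1) power_ends(1)] prod_end(2)[OF ends_in(2) power_ends(2)] circ_nonzero by simp
    also have "\<dots> = D * of_real (side (circ u) (circ (u + h)) (z ^ d))"
      using z \<open>k \<noteq> 0\<close> by (simp add: D_def side_circle norm_power flip: k_def)
    finally show ?thesis .
  qed
  \<comment> \<open>At a lift of the middle of the short arc the function of the image leaf is
    nonzero; both sides of \<open>eq\<close> are real there except for the factor \<open>D\<close>,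
    which is therefore real.\<close>
  have "Im D = 0"
  proof -
    define z where "z = circ ((u + h / 2) / d)"
    have "z ^ d = circ (u + h / 2)"
      using d_pos by (simp add: z_def circ_power)
    then have "side (circ u) (circ (u + h)) (z ^ d) \<noteq> 0"
      using side_circ_neg[of h u "u + h / 2"] h_bounds by auto
    moreover have "Im D * side (circ u) (circ (u + h)) (z ^ d) = 0"
      using arg_cong[OF eq[of z], of Im] by (simp add: z_def del: of_real_prod)
    ultimately show ?thesis by simp
  qed
  with D have "Re D \<noteq> 0"
    by (simp add: complex_eq_iff)
  moreover have "(\<Prod>l\<in>S. chord_side l z) = Re D * side (circ u) (circ (u + h)) (z ^ d)" if "norm z = 1" for z
    using arg_cong[OF eq[OF that], of Re] by (simp del: of_real_prod)
  ultimately show ?thesis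
    using that by blast
qed

section \<open>Colors of regions and lengths of their boundary arcs\<close>

definition prod_const where
  "prod_const = (SOME K. K \<noteq> 0 \<and>
     (\<forall>z. norm z = 1 \<longrightarrow> (\<Prod>l\<in>S. chord_side l z) = K * side (circ u) (circ (u + h)) (z ^ d)))"

lemma prod_const:
  "prod_const \<noteq> 0"
  "norm z = 1 \<Longrightarrow> (\<Prod>l\<in>S. chord_side l z) = prod_const * side (circ u) (circ (u + h)) (z ^ d)"
proof -
  have "\<exists>K. K \<noteq> 0 \<and>
     (\<forall>z. norm z = 1 \<longrightarrow> (\<Prod>l\<in>S. chord_side l z) = K * side (circ u) (circ (u + h)) (z ^ d))"
    using prod_chord_side_eq_side by metis
  from someI_ex[OF this] show "prod_const \<noteq> 0"
    "norm z = 1 \<Longrightarrow> (\<Prod>l\<in>S. chord_side l z) = prod_const * side (circ u) (circ (u + h)) (z ^ d)"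
    unfolding prod_const_def by blast+
qed

text \<open>The factor \<open>prod_const\<close> makes this the exact constant in
  \<open>prod_region_side\<close>, so that its sign tells \<open>C\<close>-regions from
  \<open>R\<close>-regions.\<close>

definition color :: "complex set \<Rightarrow> real" where
  "color R = (\<Prod>l\<in>S. region_side l R) * prod_const"

lemma color_nonzero: "R \<in> portrait \<Longrightarrow> color R \<noteq> 0"
  using region_side_cases[of R] prod_const(1) finite_S by (fastforce simp: color_def)

lemma prod_region_side: "norm z = 1 \<Longrightarrow>
    (\<Prod>l\<in>S. region_side l R * chord_side l z) = color R * side (circ u) (circ (u + h)) (z ^ d)"
  by (simp add: prod.distrib prod_const(2) color_def)

text \<open>With a negative color the product is positive where the function of the image leaf is
  negative, over the short arc from \<open>circ u\<close> to \<open>circ (u + h)\<close>.\<close>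

lemma boundary_arcs_neg:
  assumes R: "R \<in> portrait" "color R < 0" and A: "A \<in> boundary_arcs R"
  obtains i :: nat where "A = circ ` {(u + i) / d .. (u + i) / d + h / d}"
proof -
  define G where "G w = color R * side (circ u) (circ (u + h)) w" for w
  have prod: "(\<Prod>l\<in>S. region_side l R * chord_side l z) = G (z ^ d)" if "norm z = 1" for z
    unfolding G_def by (rule prod_region_side[OF that])
  have pos: "G (circ t) > 0" if "u < t" "t < u + h" for t
    unfolding G_def using that h_bounds R(2) by (intro mult_neg_neg side_circ_neg) auto
  have neg: "G (circ t) < 0" if "u + h < t" "t < u + 1" for t
    unfolding G_def using that h_bounds R(2) by (intro mult_neg_pos side_circ_pos) auto
  have "h < 1" using h_bounds by simp
  then show ?thesis
    by (rule boundary_arcs_cases[where G = G and u = u, OF R(1) d_pos h_bounds(1) _ _ _ _ A])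
      (erule prod that | erule (1) pos neg)+
qed

text \<open>The long arc takes the place of the short one: it starts at \<open>u + h\<close> and has
  length \<open>1 - h\<close>.\<close>

lemma boundary_arcs_pos:
  assumes R: "R \<in> portrait" "color R > 0" and A: "A \<in> boundary_arcs R"
  obtains s where "A = circ ` {s .. s + (1 - h) / d}"
proof -
  define G where "G w = color R * side (circ u) (circ (u + h)) w" for w
  have prod: "(\<Prod>l\<in>S. region_side l R * chord_side l z) = G (z ^ d)" if "norm z = 1" for z
    unfolding G_def by (rule prod_region_side[OF that])
  have pos: "G (circ t) > 0" if "u + h < t" "t < u + h + (1 - h)" for t
    unfolding G_def using that h_bounds R(2) by (intro mult_pos_pos side_circ_pos) auto
  \<comment> \<open>Past \<open>u + 1\<close> the parameter is on the short arc again; subtracting 1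
    brings it into the range of \<open>side_circ_neg\<close>.\<close>
  have neg: "G (circ t) < 0" if t: "u + h + (1 - h) < t" "t < u + h + 1" for t
  proof -
    have "side (circ u) (circ (u + h)) (circ (t - 1)) < 0"
      using t h_bounds by (intro side_circ_neg) auto
    moreover have "circ (t - 1) = circ t"
      using circ_add_int[of t "- 1"] by simp
    ultimately show ?thesis
      unfolding G_def using R(2) by (simp add: mult_pos_neg)
  qed
  have "0 < 1 - h" "1 - h < 1" using h_bounds by simp_all
  then show ?thesis
    by (rule boundary_arcs_cases[where G = G and u = "u + h", OF R(1) d_pos _ _ _ _ _ A])
      (erule prod that | erule (1) pos neg)+
qed

lemma h_over_d: "0 < h / d" "h / d < 1 / (2 * real d)" "1 / (2 * real d) < (1 - h) / d" "(1 - h) / d < 1"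
proof -
  have "1 - h < real d"
    using d_pos h_bounds by linarith
  then show "0 < h / d" "h / d < 1 / (2 * real d)" "1 / (2 * real d) < (1 - h) / d" "(1 - h) / d < 1"
    using d_pos h_bounds by (simp_all add: field_simps)
qed

lemma arc_length_neg:
  assumes "R \<in> portrait" "color R < 0" "A \<in> boundary_arcs R"
  shows "arc_length A < 1 / (2 * real d)"
proof -
  obtain i :: nat where i: "A = circ ` {(u + i) / d .. (u + i) / d + h / d}"
    by (rule boundary_arcs_neg[OF assms])
  have "arc_length A = h / d"
    unfolding i using h_over_d by (intro arc_length_circ) linarith+
  then show ?thesis using h_over_d by linarith
qed

lemma arc_length_pos:
  assumes "R \<in> portrait" "color R > 0" "A \<in> boundary_arcs R"
  shows "arc_length A > 1 / (2 * real d)"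
proof -
  obtain s where s: "A = circ ` {s .. s + (1 - h) / d}"
    by (rule boundary_arcs_pos[OF assms])
  have "arc_length A = (1 - h) / d"
    unfolding s using h_over_d by (intro arc_length_circ) linarith+
  then show ?thesis using h_over_d by linarith
qed

text \<open>A region has at least one boundary arc, so the two length conditions, which would both
  hold vacuously without arcs, exclude each other.\<close>

lemma region_cases:
  assumes "R \<in> portrait"
  shows "C_region d S R \<longleftrightarrow> color R < 0" "R_region d S R \<longleftrightarrow> color R > 0"
proof -
  obtain A where A: "A \<in> boundary_arcs R"
    using boundary_arcs_nonempty[OF assms] by blast
  consider "color R < 0" | "color R > 0"
    using color_nonzero[OF assms] by linarith
  then have "(C_region d S R \<longleftrightarrow> color R < 0) \<and> (R_region d S R \<longleftrightarrow> color R > 0)"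
  proof cases
    case 1
    then have "\<forall>A\<in>boundary_arcs R. arc_length A < 1 / (2 * real d)"
      using arc_length_neg[OF assms] by blast
    with 1 A assms show ?thesis
      unfolding C_region_def R_region_def by fastforce
  next
    case 2
    then have "\<forall>A\<in>boundary_arcs R. arc_length A > 1 / (2 * real d)"
      using arc_length_pos[OF assms] by blast
    with 2 A assms show ?thesis
      unfolding C_region_def R_region_def by fastforce
  qed
  then show "C_region d S R \<longleftrightarrow> color R < 0" "R_region d S R \<longleftrightarrow> color R > 0"
    by blast+
qed

lemma C_region_iff: "C_region d S R \<longleftrightarrow> R \<in> portrait \<and> color R < 0"
  and R_region_iff: "R_region d S R \<longleftrightarrow> R \<in> portrait \<and> color R > 0"
  using region_cases[of R] by (auto simp: C_region_def R_region_def)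

text \<open>Crossing a leaf changes only the sign at that leaf, so one factor of the product is
  negated.\<close>

lemma color_edge:
  assumes "l \<in> S" "mends (dual_graph S) l = {R, R'}"
  shows "color R' = - color R"
proof -
  have "(\<Prod>k\<in>S. region_side k R') = region_side l R' * (\<Prod>k\<in>S - {l}. region_side k R')"
    by (rule prod.remove[OF finite_S assms(1)])
  also have "\<dots> = - region_side l R * (\<Prod>k\<in>S - {l}. region_side k R)"
    using region_side_edge[OF assms] assms(1) by simp
  also have "\<dots> = - (\<Prod>k\<in>S. region_side k R)"
    by (simp add: prod.remove[OF finite_S assms(1)])
  finally show ?thesis by (simp add: color_def)
qed

lemma bicoloring_dual_graph:
  "bicoloring (dual_graph S) {R. C_region d S R} {R. R_region d S R}"
  unfolding bicoloring_def C_region_iff R_region_iff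
proof (intro conjI ballI allI impI)
  show "{R \<in> portrait. color R < 0} \<union> {R \<in> portrait. 0 < color R} = mverts (dual_graph S)"
    using color_nonzero by (auto simp: neq_iff)
  fix l R R' assume "l \<in> medges (dual_graph S)" "mends (dual_graph S) l = {R, R'}"
  then have "color R' = - color R"
    using color_edge by simp
  then show "\<not> (R \<in> {R \<in> portrait. color R < 0} \<and> R' \<in> {R \<in> portrait. color R < 0})"
    "\<not> (R \<in> {R \<in> portrait. 0 < color R} \<and> R' \<in> {R \<in> portrait. 0 < color R})"
    by auto
qed auto

section \<open>Long leaves and the central strip\<close>

lemma leaf_length_le:
  assumes "x \<in> sphere 0 1" "y \<in> sphere 0 1"
  shows "leaf_length (closed_segment x y) \<le> arc_length (ccw_arc x y)"
proof -
  let ?M = "{arc_length (ccw_arc a b) | a b. a \<in> sphere 0 1 \<and> b \<in> sphere 0 1 \<and>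
     closed_segment x y = closed_segment a b}"
  \<comment> \<open>A segment determines its ends up to order, so \<open>Min\<close> is taken over a
    finite set.\<close>
  have "?M \<subseteq> (\<lambda>(a, b). arc_length (ccw_arc a b)) ` ({x, y} \<times> {x, y})"
    by (auto simp: doubleton_eq_iff)
  then have "finite ?M"
    by (rule finite_subset) auto
  then show ?thesis
    unfolding leaf_length_def using assms by (intro Min_le) auto
qed

text \<open>A \<open>C\<close>-region of degree one is bounded by a single leaf, whose ends are the ends of a
  short arc.\<close>

lemma degree_C_region:
  assumes "C_region d S R" "l \<in> S" "l \<subseteq> frontier R" "leaf_length l > 1 / (2 * real d)"
  shows "region_degree S R \<ge> 2"
proof (rule ccontr)
  assume deg: "\<not> region_degree S R \<ge> 2"
  have R: "R \<in> portrait" "color R < 0"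
    using assms C_region_iff by auto
  have only: "k = l" if "k \<in> S" "k \<subseteq> frontier R" for k
  proof -
    have "card {l \<in> S. l \<subseteq> frontier R} \<le> 1"
      using deg by (simp add: region_degree_def)
    then show ?thesis
      using card_le_Suc0_iff_eq[of "{l \<in> S. l \<subseteq> frontier R}"] finite_S assms that by auto
  qed
  obtain A where A: "A \<in> boundary_arcs R"
    using boundary_arcs_nonempty[OF R(1)] by blast
  then obtain i :: nat where i: "A = circ ` {(u + i) / d .. (u + i) / d + h / d}"
    using boundary_arcs_neg R by blast
  \<comment> \<open>\<open>A\<close> runs from \<open>circ s\<close>, a root of
    \<open>circ u\<close>, to \<open>circ (s + h / d)\<close>, a root of
    \<open>circ (u + h)\<close>. All such roots are ends of leaves, which yields \<open>k\<close>
    and \<open>m\<close>.\<close>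
  define s where "s = (u + i) / d"
  have A_sub: "A \<subseteq> closure R"
    using A in_components_subset by (auto simp: boundary_arcs_def)
  have in_A: "circ s \<in> A" "circ (s + h / d) \<in> A"
    using h_over_d unfolding i s_def[symmetric] by auto
  have ds: "d * s = u + i"
    using d_pos by (simp add: s_def)
  moreover have "d * (s + h / d) = u + h + i"
    using d_pos by (simp add: distrib_left ds)
  ultimately have "circ s ^ d = circ u" "circ (s + h / d) ^ d = circ (u + h)"
    using circ_add_int[of u i] circ_add_int[of "u + h" i] by (simp_all add: circ_power)
  then have "circ s \<in> a ` S" "circ (s + h / d) \<in> b ` S"
    using prod_end(1)[OF ends_in(1) power_ends(1) circ_nonzero]
      prod_end(1)[OF ends_in(2) power_ends(2) circ_nonzero] by simp_all
  then obtain k m where km: "k \<in> S" "circ s = a k" "m \<in> S" "circ (s + h / d) = b m"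
    by auto
  \<comment> \<open>Both ends of \<open>A\<close> are in the closure of \<open>R\<close>, so
    \<open>k\<close> and \<open>m\<close> border \<open>R\<close>. As only \<open>l\<close> does,
    \<open>l\<close> joins the ends of \<open>A\<close>.\<close>
  have "k \<subseteq> frontier R"
    using ends_in(1)[OF km(1)] in_A A_sub km by (intro adjacentI[OF R(1), of _ "a k"]) auto
  moreover have "m \<subseteq> frontier R"
    using ends_in(2)[OF km(3)] in_A A_sub km by (intro adjacentI[OF R(1), of _ "b m"]) auto
  ultimately have kl: "k = l" "m = l"
    using only km by blast+
  have "l = closed_segment (circ s) (circ (s + h / d))"
    unfolding km(2,4) kl by (rule chord_eq[OF assms(2)])
  moreover have "arc_length (ccw_arc (circ s) (circ (s + h / d))) = h / d"
    using h_over_d by (simp add: ccw_arc_circ arc_length_circ)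
  ultimately have "leaf_length l \<le> h / d"
    using leaf_length_le[of "circ s" "circ (s + h / d)"] by simp
  then show False
    using assms(4) h_over_d by linarith
qed

text \<open>The two regions along a long leaf have opposite colors, so one of them is a
  \<open>C\<close>-region, and \<open>degree_C_region\<close> bounds its degree.\<close>

lemma central_strip_nonempty:
  assumes "l \<in> S" "leaf_length l > 1 / (2 * real d)"
  shows "central_strip d S \<noteq> {}"
proof -
  obtain R R' where RR: "{R \<in> portrait. l \<subseteq> frontier R} = {R, R'}"
    by (rule ends_of_leaf[OF assms(1)])
  then have R: "R \<in> portrait" "R' \<in> portrait" "l \<subseteq> frontier R" "l \<subseteq> frontier R'"
    by blast+
  have "color R' = - color R"
    by (rule color_edge[OF assms(1)]) (simp only: RR dual_graph_simps)
  then have "color R < 0 \<or> color R' < 0"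
    using color_nonzero[OF R(1)] by linarith
  then obtain Q where Q: "Q \<in> portrait" "color Q < 0" "l \<subseteq> frontier Q"
    using R by metis
  then have C: "C_region d S Q"
    by (simp add: C_region_iff)
  have "Q \<subseteq> closure Q"
    by (rule closure_subset)
  also have "\<dots> \<subseteq> central_strip d S"
    unfolding central_strip_def using C degree_C_region[OF C assms(1) Q(3) assms(2)]
    by (intro closure_mono Union_upper CollectI conjI)
  finally show ?thesis
    using portrait_nonempty[OF Q(1)] by auto
qed

end

text \<open>The image leaf is written counterclockwise along its shorter arc, which is unique since
  the leaf is no diameter; the ends of each leaf are then ordered to match.\<close>

lemma sibling_chords_exist:
  fixes L S :: "complex set set" and d :: nat
  assumes "lamination L" "full_sibling_collection d L S" "l1 \<in> S" "\<not> diameter_chord (leaf_map d l1)"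
  shows "\<exists>a b u h. sibling_chords S a b d u h"
proof -
  have S: "S \<subseteq> L" "finite S" "card S = d"
    "\<And>l k. l \<in> S \<Longrightarrow> k \<in> S \<Longrightarrow> l \<noteq> k \<Longrightarrow> l \<inter> k = {}"
    using assms(2) unfolding full_sibling_collection_def by simp_all
  from assms(2) obtain l' where l'_props: "\<not> degenerate l'" "\<forall>l\<in>S. leaf_map d l = l'"
    unfolding full_sibling_collection_def by (elim conjE bexE) (rule that)
  have image: "\<exists>x y. x \<in> sphere 0 1 \<and> y \<in> sphere 0 1 \<and> l = closed_segment x y \<and>
      l' = closed_segment (x ^ d) (y ^ d)" if "l \<in> S" for l
  proof -
    have "chord l"
      using assms(1) S(1) that by (auto simp: lamination_def)
    then obtain x y where xy: "x \<in> sphere 0 1" "y \<in> sphere 0 1" "l = closed_segment x y"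
      by (auto simp: chord_def)
    then have "l' = closed_segment (x ^ d) (y ^ d)"
      using leaf_map_closed_segment[of x y d] l'_props(2) that by (auto simp: sigma_map_eq_power)
    with xy show ?thesis by blast
  qed
  obtain x y where xy: "x \<in> sphere 0 1" "y \<in> sphere 0 1" "l' = closed_segment (x ^ d) (y ^ d)"
    using image[OF assms(3)] by blast
  define t h where "t = param (x ^ d)" and "h = frac (param (y ^ d) - param (x ^ d))"
  have circ_t: "circ t = x ^ d"
    using xy by (simp add: t_def circ_param norm_power)
  have circ_th: "circ (t + h) = y ^ d"
  proof -
    have "circ (t + h) = circ (param (y ^ d))"
      unfolding circ_eq_iff by (simp add: t_def h_def frac_def)
    then show ?thesis
      using xy by (simp add: circ_param norm_power)
  qed
  have l': "l' = closed_segment (circ t) (circ (t + h))"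
    using xy by (simp add: circ_t circ_th)
  have "h \<noteq> 0"
    using l'_props(1) unfolding l' degenerate_def by auto
  moreover have "h \<noteq> 1 / 2"
  proof
    assume "h = 1 / 2"
    then have "2 * pi * (t + h) = 2 * pi * t + pi"
      by (simp add: distrib_left)
    then have "circ (t + h) = - circ t"
      by (simp add: circ_def complex_eq_iff)
    then have "diameter_chord l'"
      unfolding l' diameter_chord_def using circ_in_sphere by auto
    then show False
      using assms(3,4) l'_props(2) by simp
  qed
  moreover have "0 \<le> h" "h < 1"
    by (simp_all add: h_def frac_lt_1)
  ultimately have "\<exists>u k. 0 < k \<and> k < 1 / 2 \<and> l' = closed_segment (circ u) (circ (u + k))"
  proof (cases "h < 1 / 2")
    \<comment> \<open>The arc from \<open>circ t\<close> is the longer one, so \<open>u\<close> is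
      taken at its end \<open>t + h\<close>, and the complementary arc has length
      \<open>1 - h\<close>.\<close>
    case False
    have "circ (t + h + (1 - h)) = circ t"
      using circ_add_int[of t 1] by simp
    then have "l' = closed_segment (circ (t + h)) (circ (t + h + (1 - h)))"
      by (simp add: l' closed_segment_commute)
    moreover have "0 < 1 - h" "1 - h < 1 / 2"
      using False \<open>h < 1\<close> \<open>h \<noteq> 1 / 2\<close> by auto
    ultimately show ?thesis by blast
  next
    case True
    then show ?thesis
      using l' \<open>h \<noteq> 0\<close> \<open>0 \<le> h\<close> by (intro exI[of _ t] exI[of _ h]) auto
  qed
  then obtain u k where uk: "0 < k" "k < 1 / 2" "l' = closed_segment (circ u) (circ (u + k))"
    by blast
  \<comment> \<open>The ends are bundled into a pair, so that a single choice yields both functions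
    with matching order.\<close>
  have "\<exists>p. fst p \<in> sphere 0 1 \<and> snd p \<in> sphere 0 1 \<and> l = closed_segment (fst p) (snd p) \<and>
      fst p ^ d = circ u \<and> snd p ^ d = circ (u + k)" if l: "l \<in> S" for l
  proof -
    obtain x y where xy: "x \<in> sphere 0 1" "y \<in> sphere 0 1" "l = closed_segment x y"
      "l' = closed_segment (x ^ d) (y ^ d)"
      using image[OF l] by blast
    then have "x ^ d = circ u \<and> y ^ d = circ (u + k) \<or> y ^ d = circ u \<and> x ^ d = circ (u + k)"
      using uk(3) by (auto simp: doubleton_eq_iff)
    then show ?thesis
    proof
      assume "x ^ d = circ u \<and> y ^ d = circ (u + k)"
      then show ?thesis
        using xy by (intro exI[of _ "(x, y)"]) auto
    next
      assume "y ^ d = circ u \<and> x ^ d = circ (u + k)"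
      then show ?thesis
        using xy by (intro exI[of _ "(y, x)"]) (auto simp: closed_segment_commute)
    qed
  qed
  then obtain p where p: "\<And>l. l \<in> S \<Longrightarrow> fst (p l) \<in> sphere 0 1 \<and> snd (p l) \<in> sphere 0 1 \<and>
      l = closed_segment (fst (p l)) (snd (p l)) \<and>
      fst (p l) ^ d = circ u \<and> snd (p l) ^ d = circ (u + k)"
    by metis
  have circ_neq: "circ u \<noteq> circ (u + k)"
    using uk by (auto simp: circ_eq_iff elim!: Ints_cases)
  have "sibling_chords S (\<lambda>l. fst (p l)) (\<lambda>l. snd (p l)) d u k"
  proof
    fix l assume l: "l \<in> S"
    show "norm (fst (p l)) = 1" "norm (snd (p l)) = 1"
      using p[OF l] by auto
    show "fst (p l) \<noteq> snd (p l)"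
      using p[OF l] circ_neq by metis
    show "l = closed_segment (fst (p l)) (snd (p l))" "fst (p l) ^ d = circ u" "snd (p l) ^ d = circ (u + k)"
      using p[OF l] by blast+
  qed (use S uk assms(3) in auto)
  then show ?thesis by blast
qed

theorem theorem2p3:
  fixes d :: nat and L S :: "complex set set" and l1 :: "complex set"
  assumes "d \<ge> 2"
    and "lamination L"
    and "sibling_invariant d L"
    and "full_sibling_collection d L S"
    and "l1 \<in> S"
    and "\<not> diameter_chord (leaf_map d l1)"
  shows "((\<exists>l\<in>S. leaf_length l > 1 / (2 * real d)) \<longrightarrow> central_strip d S \<noteq> {}) \<and>
    (planar (dual_graph S) \<and> mtree (dual_graph S) \<and>
     bicoloring (dual_graph S) {R. C_region d S R} {R. R_region d S R})"
proof -
  obtain a b u h where "sibling_chords S a b d u h"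
    using sibling_chords_exist assms by blast
  then interpret sibling_chords S a b d u h .
  show ?thesis
    using central_strip_nonempty planar_dual_graph mtree_dual_graph bicoloring_dual_graph by blast
qed

end
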